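(* Every solution $u$ of the cubic Szegő equation $i\partial_tu=\Pi(|u|^2u)$ on $W(3)$ satisfies $$\forall s>\tfrac12,\qquad \sup_{t\in\mathbb R}\|u(t)\|_{H^s}<+\infty.$$ However, there exists a family $(u_0^\varepsilon)_{\varepsilon>0}$ of Cauchy data in $W(3)$, which converges in $W(3)$ for the $C^\infty(\mathbb S^1)$ topology as $\varepsilon\to0$, such that the corresponding solutions $u^\varepsilon$ (with $u^\varepsilon(0)=u_0^\varepsilon$) satisfy: for every $\varepsilon>0$ there exists $t^\varepsilon>0$ such that, for every $s>\frac12$, $$\|u^\varepsilon(t^\varepsilon)\|_{H^s}\longrightarrow+\infty\quad\text{as }\varepsilon\to0 .$$
   Context: $\mathbb S^1$ is the unit circle in $\mathbb C$. $E_+$ denotes the subspace of elements $u$ of a space $E$ of distributions on $\mathbb S^1$ with $\hat u(k)=0$ for all $k<0$; $\Pi:L^2(\mathbb S^1)\to L^2_+$ is the orthogonal projector. $H^s$ is the Sobolev space on $\mathbb S^1$, with norm $\|u\|_{H^s}^2=\sum_k(1+|k|^2)^s|\hat u(k)|^2$. $W(3)$ is the set of functions $u(z)=\frac{az+b}{1-pz}$ with $a\in\mathbb C\setminus\{0\}$, $b\in\mathbb C$, $|p|<1$ and $a+bp\neq0$ (numerator and denominator without common factor); it is a complex manifold of dimension 3, contained in $H^s_+$ for every $s$ and invariant under the flow of the equation. For each $u_0\in H^{1/2}_+$ the equation has a unique solution $u\in C(\mathbb R,H^{1/2}_+)$ with $u(0)=u_0$. *)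

theory Defs
  imports "HOL-Analysis.Analysis"
begin

text \<open>
  Functions on the unit circle are maps \<^typ>\<open>complex \<Rightarrow> complex\<close> of which only the values on
  \<^term>\<open>sphere (0::complex) 1\<close> matter. Elements of \<open>L\<^sup>2\<close> are represented by functions, so two
  functions that agree almost everywhere represent the same element.
\<close>

definition circle :: "complex measure" where
  "circle = distr (uniform_measure lborel {0..2 * pi}) (restrict_space borel (sphere 0 1)) cis"

lemma measurable_cis_circle:
  "cis \<in> uniform_measure lborel {0..2 * pi} \<rightarrow>\<^sub>M restrict_space borel (sphere 0 1)"
proof -
  have "cis \<in> borel_measurable borel"
    by (intro borel_measurable_continuous_onI continuous_intros)
  then show ?thesis
    by (intro measurable_restrict_space2) (auto simp: uniform_measure_def)
qed

lemma integral_circle: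
  fixes f :: "complex \<Rightarrow> complex"
  assumes f: "f \<in> borel_measurable (restrict_space borel (sphere 0 1))"
  shows "(\<integral>z. f z \<partial>circle) = (LBINT x:{0..2 * pi}. f (cis x)) / of_real (2 * pi)"
proof -
  have fc: "(\<lambda>x. f (cis x)) \<in> borel_measurable lborel"
    using measurable_compose[OF measurable_cis_circle f] by simp
  have eq: "uniform_measure lborel {0..2 * pi} =
      density lborel (\<lambda>x. ennreal (indicator {0..2 * pi} x / (2 * pi)))"
    unfolding uniform_measure_def
    by (intro arg_cong2[of _ _ _ _ density] ext refl)
      (auto simp: indicator_def divide_ennreal[symmetric])
  have "(\<integral>z. f z \<partial>circle) = (\<integral>x. f (cis x) \<partial>uniform_measure lborel {0..2 * pi})"
    unfolding circle_def by (rule integral_distr[OF measurable_cis_circle f])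
  also have "\<dots> = (\<integral>x. (indicator {0..2 * pi} x / (2 * pi)) *\<^sub>R f (cis x) \<partial>lborel)"
    unfolding eq by (subst integral_density) (use fc in \<open>auto simp: indicator_def\<close>)
  also have "\<dots> = (\<integral>x. (indicator {0..2 * pi} x *\<^sub>R f (cis x)) / of_real (2 * pi) \<partial>lborel)"
    by (intro Bochner_Integration.integral_cong) (auto simp: indicator_def scaleR_conv_of_real)
  also have "\<dots> = (LBINT x:{0..2 * pi}. f (cis x)) / of_real (2 * pi)"
    unfolding set_lebesgue_integral_def by simp
  finally show ?thesis .
qed

definition L2 :: "(complex \<Rightarrow> complex) set" where
  "L2 = {f. f \<in> borel_measurable circle \<and> integrable circle (\<lambda>z. (norm (f z))\<^sup>2)}"

definition L2_inner :: "(complex \<Rightarrow> complex) \<Rightarrow> (complex \<Rightarrow> complex) \<Rightarrow> complex" where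
  "L2_inner f g = (\<integral>z. f z * cnj (g z) \<partial>circle)"

definition L2_norm :: "(complex \<Rightarrow> complex) \<Rightarrow> real" where
  "L2_norm f = sqrt (\<integral>z. (norm (f z))\<^sup>2 \<partial>circle)"

definition fourier_coeff :: "(complex \<Rightarrow> complex) \<Rightarrow> int \<Rightarrow> complex" where
  "fourier_coeff f k = (\<integral>z. f z * z powi (- k) \<partial>circle)"

definition nonneg_freq :: "(complex \<Rightarrow> complex) set \<Rightarrow> (complex \<Rightarrow> complex) set" where
  "nonneg_freq E = {f \<in> E. \<forall>k<0. fourier_coeff f k = 0}"

text \<open>
  The projection of \<open>f \<in> L\<^sup>2\<close> is determined up to a null set; \<open>SOME\<close> picks a representative.
\<close>

definition szego_proj :: "(complex \<Rightarrow> complex) \<Rightarrow> (complex \<Rightarrow> complex)" where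
  "szego_proj f =
     (SOME g. g \<in> nonneg_freq L2 \<and> (\<forall>h\<in>nonneg_freq L2. L2_inner (\<lambda>z. f z - g z) h = 0))"

text \<open>Only \<open>s \<ge> 0\<close> is intended, where all elements of \<open>H\<^sup>s\<close> are functions in \<open>L\<^sup>2\<close>.\<close>

definition Hs_weight :: "real \<Rightarrow> (complex \<Rightarrow> complex) \<Rightarrow> int \<Rightarrow> real" where
  "Hs_weight s f k = (1 + (real_of_int k)\<^sup>2) powr s * (norm (fourier_coeff f k))\<^sup>2"

definition Hs :: "real \<Rightarrow> (complex \<Rightarrow> complex) set" where
  "Hs s = {f \<in> L2. Hs_weight s f summable_on UNIV}"

text \<open>Meaningful only on \<^term>\<open>Hs s\<close>: outside, the value is the default of \<^const>\<open>infsum\<close>.\<close>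

definition Hs_norm :: "real \<Rightarrow> (complex \<Rightarrow> complex) \<Rightarrow> real" where
  "Hs_norm s f = sqrt (\<Sum>\<^sub>\<infinity>k. Hs_weight s f k)"

definition has_L2_derivative ::
  "(real \<Rightarrow> complex \<Rightarrow> complex) \<Rightarrow> (complex \<Rightarrow> complex) \<Rightarrow> real \<Rightarrow> bool" where
  "has_L2_derivative u v t \<longleftrightarrow>
     ((\<lambda>h. L2_norm (\<lambda>z. (u (t + h) z - u t z) / of_real h - v z)) \<longlongrightarrow> 0) (at 0)"

text \<open>
  Solutions in \<open>C(\<real>, H\<^sup>1\<^sup>/\<^sup>2\<^sub>+)\<close>. Since \<open>H\<^sup>1\<^sup>/\<^sup>2\<close> embeds into \<open>L\<^sup>6\<close>, the nonlinearity lies in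
  \<open>C(\<real>, L\<^sup>2)\<close>, so the time derivative exists in \<open>L\<^sup>2\<close>, which is how the equation is read here
  (solved for the time derivative).
\<close>

definition szego_solution :: "(real \<Rightarrow> complex \<Rightarrow> complex) \<Rightarrow> bool" where
  "szego_solution u \<longleftrightarrow>
     (\<forall>t. u t \<in> nonneg_freq (Hs (1/2))) \<and>
     (\<forall>t. ((\<lambda>\<tau>. Hs_norm (1/2) (\<lambda>z. u \<tau> z - u t z)) \<longlongrightarrow> 0) (at t)) \<and>
     (\<forall>t. has_L2_derivative u
            (\<lambda>z. - \<i> * szego_proj (\<lambda>w. of_real ((norm (u t w))\<^sup>2) * u t w) z) t)"

definition W3 :: "(complex \<Rightarrow> complex) set" where
  "W3 = {u. \<exists>a b p. a \<noteq> 0 \<and> norm p < 1 \<and> a + b * p \<noteq> 0 \<and>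
               (\<forall>z\<in>sphere 0 1. u z = (a * z + b) / (1 - p * z))}"

definition szego_solution_on_W3 :: "(real \<Rightarrow> complex \<Rightarrow> complex) \<Rightarrow> bool" where
  "szego_solution_on_W3 u \<longleftrightarrow> szego_solution u \<and> (\<forall>t. u t \<in> W3)"

definition angular_deriv :: "nat \<Rightarrow> (complex \<Rightarrow> complex) \<Rightarrow> real \<Rightarrow> complex" where
  "angular_deriv j f = ((\<lambda>g x. vector_derivative g (at x)) ^^ j) (\<lambda>x. f (cis x))"

text \<open>
  Convergence in \<open>C\<^sup>\<infinity>\<close> of the circle, for smooth functions: uniform convergence of the derivatives
  of every order with respect to the angle.
\<close>

definition Cinf_tendsto ::
  "('a \<Rightarrow> complex \<Rightarrow> complex) \<Rightarrow> (complex \<Rightarrow> complex) \<Rightarrow> 'a filter \<Rightarrow> bool" where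
  "Cinf_tendsto f g F \<longleftrightarrow>
     (\<forall>j. uniform_limit UNIV (\<lambda>e. angular_deriv j (f e)) (angular_deriv j g) F)"

end

theory Submission
  imports Defs "HOL-Real_Asymp.Real_Asymp"
begin

text \<open>
  Write a point of \<open>W(3)\<close> as \<open>u = b + c z / (1 - p z)\<close> and put \<open>r = 1 - |p|\<^sup>2\<close>. Since
  \<open>|u|\<^sup>2 u\<close> is rational on the circle, its projection is explicit and the equation becomes an ODE
  for \<open>(b, c, p)\<close>. It conserves the mass \<open>Q = |b|\<^sup>2 + |c|\<^sup>2 / r\<close>, the momentum
  \<open>M = |c|\<^sup>2 / r\<^sup>2\<close> and \<open>|a|\<close>, where \<open>a = c - b p\<close>, and
  \<open>Q - |a|\<^sup>2 = r |u(cnj p)|\<^sup>2\<close>. Because \<open>|u(cnj p)| \<le> sqrt Q + sqrt M\<close>, the gap \<open>r\<close> stays away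
  from \<open>0\<close> if \<open>|a|\<^sup>2 \<noteq> Q\<close>; otherwise \<open>u(cnj p) = 0\<close> for all times and \<open>p\<close> is constant. With \<open>r\<close>
  bounded below, all Sobolev norms are bounded.

  The datum \<open>z + 2\<epsilon>\<close> has \<open>M = 1\<close> and \<open>Q - |a|\<^sup>2 = 4\<epsilon>\<^sup>2\<close>, so nothing prevents \<open>r\<close> from becoming of
  order \<open>\<epsilon>\<^sup>2\<close>. The ODE is solved in closed form, and \<open>r = \<epsilon>\<^sup>2 / (1 + \<epsilon>\<^sup>2)\<close> is attained. The
  momentum \<open>M = 1\<close> is then carried by a tail of mass \<open>r\<close>, hence by frequencies of order
  \<open>1 / r\<close>, which forces the \<open>H\<^sup>s\<close> norm to grow like \<open>r powr (1/2 - s)\<close>.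
\<close>

section \<open>Fourier coefficients and square integrable functions on the circle\<close>

lemma has_vector_derivative_cis:
  assumes "(g has_real_derivative g') (at x within S)"
  shows "((\<lambda>x. cis (g x)) has_vector_derivative of_real g' * \<i> * cis (g x)) (at x within S)"
  using has_derivative_cis[OF assms[unfolded has_field_derivative_def]]
  by (simp add: has_vector_derivative_def scaleR_conv_of_real mult_ac)

lemma space_circle [simp]: "space circle = sphere 0 1"
  by (simp add: circle_def space_restrict_space)

lemma sets_circle [measurable_cong]: "sets circle = sets (restrict_space borel (sphere 0 1))"
  by (simp add: circle_def)

lemma emeasure_circle: "emeasure circle (space circle) = 1"
proof -
  have ne: "emeasure lborel {0..2 * pi} \<noteq> 0" "emeasure lborel {0..2 * pi} \<noteq> \<infinity>"
    by simp_all
  have "emeasure (uniform_measure lborel {0..2 * pi}) (space (uniform_measure lborel {0..2 * pi})) = 1"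
    using emeasure_uniform_measure_1[OF ne] by simp
  moreover have "cis -` space circle \<inter> space (uniform_measure lborel {0..2 * pi})
      = space (uniform_measure lborel {0..2 * pi})"
    by auto
  moreover have "space circle \<in> sets (restrict_space borel (sphere 0 1))"
    using sets.top[of "restrict_space borel (sphere (0::complex) 1)"] by (simp add: space_restrict_space)
  ultimately show ?thesis
    using emeasure_distr[OF measurable_cis_circle, of "space circle"]
    by (simp only: circle_def[symmetric])
qed

interpretation circle: finite_measure circle
  by standard (simp add: emeasure_circle del: space_circle)

lemma measure_circle: "measure circle (sphere 0 1) = 1"
  using emeasure_circle by (simp add: measure_def)

lemma borel_measurable_circle_cong:
  "(\<And>z. z \<in> sphere 0 1 \<Longrightarrow> f z = g z) \<Longrightarrow> f \<in> borel_measurable circle \<longleftrightarrow> g \<in> borel_measurable circle"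
  by (rule measurable_cong) simp

lemma borel_measurable_circle_continuous:
  "continuous_on (sphere 0 1) f \<Longrightarrow> f \<in> borel_measurable circle"
  using borel_measurable_continuous_on_restrict[of "sphere 0 1" f]
  by (simp add: measurable_cong_sets[OF sets_circle refl])

lemma integrable_mult_continuous_circle:
  fixes g h :: "complex \<Rightarrow> complex"
  assumes g: "continuous_on (sphere 0 1) g" and h: "integrable circle h"
  shows "integrable circle (\<lambda>z. g z * h z)"
proof -
  have "bounded (g ` sphere 0 1)"
    by (intro compact_imp_bounded compact_continuous_image g) simp
  then obtain B where B: "\<And>z. z \<in> sphere 0 1 \<Longrightarrow> norm (g z) \<le> B"
    by (meson bounded_iff imageI)
  show ?thesis
  proof (rule Bochner_Integration.integrable_bound)
    show "integrable circle (\<lambda>z. B * norm (h z))"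
      using h by simp
    show "(\<lambda>z. g z * h z) \<in> borel_measurable circle"
      using borel_measurable_circle_continuous[OF g] h by measurable
    show "AE z in circle. norm (g z * h z) \<le> norm (B * norm (h z))"
    proof (intro AE_I2)
      fix z assume "z \<in> space circle"
      then have "norm (g z) * norm (h z) \<le> B * norm (h z)"
        using B[of z] by (intro mult_right_mono) simp_all
      then show "norm (g z * h z) \<le> norm (B * norm (h z))"
        by (simp add: norm_mult)
    qed
  qed
qed

lemma integrable_circle_continuous:
  fixes g :: "complex \<Rightarrow> complex"
  assumes "continuous_on (sphere 0 1) g"
  shows "integrable circle g"
  using integrable_mult_continuous_circle[OF assms, of "\<lambda>_. 1"] by simp

lemma continuous_on_circle_power_int: "continuous_on (sphere 0 1) (\<lambda>z::complex. z powi k)"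
  by (rule continuous_on_power_int) auto

lemma integral_circle_power_int:
  "(\<integral>z. (z::complex) powi k \<partial>circle) = (if k = 0 then 1 else 0)"
proof (cases "k = 0")
  case True
  then show ?thesis by (simp add: measure_circle)
next
  case False
  define F where "F = (\<lambda>x. cis (of_int k * x) / (\<i> * of_int k))"
  have cis: "cis x powi k = cis (of_int k * x)" for x
    by (simp add: cis_power_int)
  have "(\<lambda>z::complex. z powi k) \<in> borel_measurable (restrict_space borel (sphere 0 1))"
    by (intro borel_measurable_continuous_on_restrict continuous_on_circle_power_int)
  then have "(\<integral>z. z powi k \<partial>circle) = (LBINT x:{0..2 * pi}. cis (of_int k * x)) / of_real (2 * pi)"
    by (subst integral_circle) (simp_all add: cis)
  also have "(LBINT x:{0..2 * pi}. cis (of_int k * x)) = F (2 * pi) - F 0"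
    unfolding set_lebesgue_integral_def
  proof (rule integral_FTC_Icc)
    show "(F has_vector_derivative cis (of_int k * x)) (at x within {0..2 * pi})" for x
      unfolding F_def using False
      by (auto intro!: derivative_eq_intros has_vector_derivative_cis)
  qed (auto intro!: continuous_intros)
  also have "\<dots> = 0"
    using cis_multiple_2pi[of "of_int k"] by (simp add: F_def mult_ac)
  finally show ?thesis using False by simp
qed

section \<open>Fourier coefficients of integrable functions\<close>

lemma fourier_coeff_cong:
  "(\<And>z. z \<in> sphere 0 1 \<Longrightarrow> f z = g z) \<Longrightarrow> fourier_coeff f k = fourier_coeff g k"
  unfolding fourier_coeff_def by (intro Bochner_Integration.integral_cong) simp_all

lemma integrable_fourier_coeff:
  "integrable circle f \<Longrightarrow> integrable circle (\<lambda>z. f z * z powi k)"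
  using integrable_mult_continuous_circle[OF continuous_on_circle_power_int, of f k]
  by (simp add: mult.commute)

lemma fourier_coeff_add:
  assumes "integrable circle f" "integrable circle g"
  shows "fourier_coeff (\<lambda>z. f z + g z) k = fourier_coeff f k + fourier_coeff g k"
  unfolding fourier_coeff_def
  by (simp add: ring_distribs integrable_fourier_coeff assms)

lemma fourier_coeff_diff:
  assumes "integrable circle f" "integrable circle g"
  shows "fourier_coeff (\<lambda>z. f z - g z) k = fourier_coeff f k - fourier_coeff g k"
  unfolding fourier_coeff_def
  by (simp add: left_diff_distrib integrable_fourier_coeff assms)

lemma fourier_coeff_cmult: "fourier_coeff (\<lambda>z. c * f z) k = c * fourier_coeff f k"
  unfolding fourier_coeff_def by (simp add: mult.assoc)

lemma fourier_coeff_divide: "fourier_coeff (\<lambda>z. f z / c) k = fourier_coeff f k / c"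
  using fourier_coeff_cmult[of "1 / c" f] by simp

lemma fourier_coeff_const: "fourier_coeff (\<lambda>_. c) k = (if k = 0 then c else 0)"
  using integral_circle_power_int[of "-k"] by (simp add: fourier_coeff_def)

lemma fourier_coeff_id_mult:
  "fourier_coeff (\<lambda>z. z * f z) k = fourier_coeff f (k - 1)"
  unfolding fourier_coeff_def
proof (intro Bochner_Integration.integral_cong refl)
  fix z assume "z \<in> space circle"
  then have "z \<noteq> 0" by auto
  then have "z powi (- (k - 1)) = z * z powi (- k)"
    using power_int_add_1'[of z "-k"] by (simp add: add.commute)
  then show "z * f z * z powi (- k) = f z * z powi (- (k - 1))"
    by simp
qed

lemma norm_fourier_coeff_le:
  "norm (fourier_coeff f k) \<le> (\<integral>z. norm (f z) \<partial>circle)"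
proof -
  have "norm (fourier_coeff f k) \<le> (\<integral>z. norm (f z * z powi (- k)) \<partial>circle)"
    unfolding fourier_coeff_def by (rule integral_norm_bound)
  also have "\<dots> = (\<integral>z. norm (f z) \<partial>circle)"
    by (intro Bochner_Integration.integral_cong) (auto simp: norm_mult norm_power_int)
  finally show ?thesis .
qed

section \<open>Square integrable functions\<close>

lemma L2_continuous:
  assumes "continuous_on (sphere 0 1) f"
  shows "f \<in> L2"
proof -
  have "integrable circle (\<lambda>z. complex_of_real ((norm (f z))\<^sup>2))"
    by (intro integrable_circle_continuous continuous_intros assms)
  then show ?thesis
    using borel_measurable_circle_continuous[OF assms] integrable_Re[of circle]
    unfolding L2_def by fastforce
qed

lemma integrable_L2_mult:
  assumes "f \<in> L2" "g \<in> L2"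
  shows "integrable circle (\<lambda>z. f z * g z)"
proof (rule Bochner_Integration.integrable_bound)
  show "integrable circle (\<lambda>z. (norm (f z))\<^sup>2 + (norm (g z))\<^sup>2)"
    using assms by (auto simp: L2_def)
  show "(\<lambda>z. f z * g z) \<in> borel_measurable circle"
    using assms by (auto simp: L2_def)
  have "norm (f z) * norm (g z) \<le> (norm (f z))\<^sup>2 + (norm (g z))\<^sup>2" for z
    using sum_squares_bound[of "norm (f z)" "norm (g z)"]
      mult_nonneg_nonneg[OF norm_ge_zero[of "f z"] norm_ge_zero[of "g z"]] by linarith
  then show "AE z in circle. norm (f z * g z) \<le> norm ((norm (f z))\<^sup>2 + (norm (g z))\<^sup>2)"
    by (intro AE_I2) (simp add: norm_mult)
qed

lemma L2_cnj: "f \<in> L2 \<Longrightarrow> (\<lambda>z. cnj (f z)) \<in> L2"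
  using borel_measurable_continuous_onI[of cnj] measurable_compose[of f circle borel cnj borel]
  by (auto simp: L2_def intro: continuous_intros)

lemma L2_cmult: "f \<in> L2 \<Longrightarrow> (\<lambda>z. c * f z) \<in> L2"
  by (auto simp: L2_def norm_mult power_mult_distrib)

lemma L2_integrable: "f \<in> L2 \<Longrightarrow> integrable circle f"
  using integrable_L2_mult[of f "\<lambda>_. 1"] L2_continuous[of "\<lambda>_. 1"] by simp

lemma L2_add:
  assumes "f \<in> L2" "g \<in> L2"
  shows "(\<lambda>z. f z + g z) \<in> L2"
proof -
  have "integrable circle (\<lambda>z. (norm (f z + g z))\<^sup>2)"
  proof (rule Bochner_Integration.integrable_bound)
    show "integrable circle (\<lambda>z. 2 * (norm (f z))\<^sup>2 + 2 * (norm (g z))\<^sup>2)"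
      using assms by (auto simp: L2_def)
    show "(\<lambda>z. (norm (f z + g z))\<^sup>2) \<in> borel_measurable circle"
      using assms by (auto simp: L2_def)
    have "(norm (f z + g z))\<^sup>2 \<le> 2 * (norm (f z))\<^sup>2 + 2 * (norm (g z))\<^sup>2" for z
    proof -
      have "(norm (f z + g z))\<^sup>2 \<le> (norm (f z) + norm (g z))\<^sup>2"
        by (intro power_mono norm_triangle_ineq) simp
      also have "\<dots> \<le> 2 * (norm (f z))\<^sup>2 + 2 * (norm (g z))\<^sup>2"
        using sum_squares_bound[of "norm (f z)" "norm (g z)"] by (simp add: power2_sum)
      finally show ?thesis .
    qed
    then show "AE z in circle. norm ((norm (f z + g z))\<^sup>2) \<le> norm (2 * (norm (f z))\<^sup>2 + 2 * (norm (g z))\<^sup>2)"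
      by (intro AE_I2) simp
  qed
  then show ?thesis using assms by (auto simp: L2_def)
qed

lemma L2_diff:
  assumes "f \<in> L2" "g \<in> L2"
  shows "(\<lambda>z. f z - g z) \<in> L2"
  using L2_add[OF assms(1) L2_cmult[OF assms(2), of "-1"]] by simp

text \<open>The circle has total mass 1, so nonnegativity of the variance of
  \<open>norm (f z)\<close> bounds its mean by its root mean square. Each Fourier coefficient is
  thus a contraction on L2, which allows the equation to be read frequency by frequency.\<close>

lemma norm_fourier_coeff_le_L2_norm:
  assumes "f \<in> L2"
  shows "norm (fourier_coeff f k) \<le> L2_norm f"
proof -
  define m where "m = (\<integral>z. norm (f z) \<partial>circle)"
  have i: "integrable circle (\<lambda>z. norm (f z))" "integrable circle (\<lambda>z. (norm (f z))\<^sup>2)"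
    using L2_integrable[OF assms] assms by (auto simp: L2_def)
  have "0 \<le> (\<integral>z. (norm (f z) - m)\<^sup>2 \<partial>circle)"
    by simp
  also have "\<dots> = (\<integral>z. (norm (f z))\<^sup>2 - 2 * m * norm (f z) + m\<^sup>2 \<partial>circle)"
    by (intro Bochner_Integration.integral_cong refl) (simp add: power2_eq_square algebra_simps)
  also have "\<dots> = (\<integral>z. (norm (f z))\<^sup>2 \<partial>circle) - m\<^sup>2"
    using i by (simp add: measure_circle m_def[symmetric] power2_eq_square)
  finally have "m \<le> L2_norm f"
    unfolding L2_norm_def by (intro real_le_rsqrt) simp
  then show ?thesis
    using norm_fourier_coeff_le[of f k] by (simp add: m_def)
qed

lemma L2_norm_le:
  assumes "f \<in> L2" "\<And>z. z \<in> sphere 0 1 \<Longrightarrow> norm (f z) \<le> B" "B \<ge> 0"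
  shows "L2_norm f \<le> B"
proof -
  have "(\<integral>z. (norm (f z))\<^sup>2 \<partial>circle) \<le> (\<integral>z. B\<^sup>2 \<partial>circle)"
    using assms by (intro integral_mono) (auto simp: L2_def intro!: power_mono)
  then show ?thesis
    unfolding L2_norm_def using assms(3) by (intro real_le_lsqrt) (simp_all add: measure_circle)
qed

lemma L2_norm_cong_AE:
  assumes "AE z in circle. f z = g z" "f \<in> borel_measurable circle" "g \<in> borel_measurable circle"
  shows "L2_norm f = L2_norm g"
  unfolding L2_norm_def using assms by (intro arg_cong[of _ _ sqrt] integral_cong_AE) auto

section \<open>Rational functions with one pole\<close>

text \<open>The power series is the sum of \<open>p ^ n * z ^ (n + 1)\<close>. It starts at
  frequency 1, so constants and multiples of \<open>geom p\<close> are orthogonal.\<close>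

definition geom :: "complex \<Rightarrow> complex \<Rightarrow> complex" where
  "geom p z = z / (1 - p * z)"

definition wfun :: "complex \<Rightarrow> complex \<Rightarrow> complex \<Rightarrow> complex \<Rightarrow> complex" where
  "wfun b c p z = b + c * geom p z"

lemma one_minus_mult_neq_0:
  fixes p z :: complex
  assumes "norm p < 1" "norm z \<le> 1"
  shows "1 - p * z \<noteq> 0"
proof
  assume "1 - p * z = 0"
  then have "norm p * norm z = 1"
    by (metis eq_iff_diff_eq_0 norm_mult norm_one)
  moreover have "norm p * norm z \<le> norm p * 1"
    using assms by (intro mult_left_mono) simp_all
  ultimately show False using assms by simp
qed

lemma continuous_on_geom: "norm p < 1 \<Longrightarrow> continuous_on (sphere 0 1) (geom p)"
  unfolding geom_def using one_minus_mult_neq_0 by (auto intro!: continuous_intros)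

lemma continuous_on_wfun: "norm p < 1 \<Longrightarrow> continuous_on (sphere 0 1) (wfun b c p)"
  unfolding wfun_def by (intro continuous_intros continuous_on_geom)

lemma norm_geom_le:
  assumes "norm p < 1" "norm z = 1"
  shows "norm (geom p z) \<le> 1 / (1 - norm p)"
proof -
  have "1 - norm p \<le> norm (1 - p * z)"
    using norm_triangle_ineq2[of 1 "p * z"] assms by (simp add: norm_mult)
  then show ?thesis
    using assms by (simp add: geom_def norm_divide frac_le)
qed

text \<open>A resolvent identity: it turns a displacement of the pole into a factor
  \<open>p - q\<close> and so governs difference quotients in \<open>p\<close>.\<close>

lemma geom_diff:
  assumes "norm p < 1" "norm q < 1" "norm z = 1"
  shows "geom p z - geom q z = (p - q) * (geom p z * geom q z)"
  using one_minus_mult_neq_0[OF assms(1), of z] one_minus_mult_neq_0[OF assms(2), of z] assms(3)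
  by (simp add: geom_def divide_simps) (simp add: algebra_simps)

section \<open>Fourier coefficients of functions with one pole\<close>

lemma fourier_coeff_geom_mult:
  assumes p: "norm p < 1" and h: "integrable circle h"
  shows "fourier_coeff (\<lambda>z. geom p z * h z) k =
    fourier_coeff h (k - 1) + p * fourier_coeff (\<lambda>z. geom p z * h z) (k - 1)"
proof -
  have i: "integrable circle (\<lambda>z. geom p z * h z)"
    by (intro integrable_mult_continuous_circle continuous_on_geom assms)
  have "fourier_coeff (\<lambda>z. geom p z * h z) k =
      fourier_coeff (\<lambda>z. z * (h z + p * (geom p z * h z))) k"
    using one_minus_mult_neq_0[OF p]
    by (intro fourier_coeff_cong) (simp add: geom_def field_simps)
  also have "\<dots> = fourier_coeff h (k - 1) + p * fourier_coeff (\<lambda>z. geom p z * h z) (k - 1)"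
    by (simp add: fourier_coeff_id_mult fourier_coeff_add fourier_coeff_cmult h i)
  finally show ?thesis .
qed

text \<open>
  The recursion \<open>geom p z = z + p z geom p z\<close> gives \<open>n\<close>-fold decay by \<open>p ^ n\<close> along decreasing
  frequencies, while Fourier coefficients are bounded.
\<close>

lemma fourier_coeff_geom_mult_eq_0:
  assumes p: "norm p < 1" and h: "integrable circle h"
    and neg: "\<And>j. j < m \<Longrightarrow> fourier_coeff h j = 0" and k: "k \<le> m"
  shows "fourier_coeff (\<lambda>z. geom p z * h z) k = 0"
proof -
  let ?g = "\<lambda>z. geom p z * h z"
  define B where "B = (\<integral>z. norm (?g z) \<partial>circle)"
  have eq: "fourier_coeff ?g k = p ^ n * fourier_coeff ?g (k - int n)" for n
  proof (induction n)
    case (Suc n)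
    \<comment> \<open>The factor \<open>z\<close> in the recursion moves \<open>h\<close> to the
      index \<open>k - n - 1\<close>, which lies below \<open>m\<close> even for
      \<open>k = m\<close> and \<open>n = 0\<close>. Hence the vanishing reaches \<open>m\<close>
      itself.\<close>
    have "fourier_coeff ?g (k - int n) = p * fourier_coeff ?g (k - int (Suc n))"
      using fourier_coeff_geom_mult[OF p h, of "k - int n"] neg k by (simp add: algebra_simps)
    then show ?case using Suc by (simp add: mult_ac)
  qed simp
  have "norm (fourier_coeff ?g k) \<le> norm p ^ n * B" for n
    using norm_fourier_coeff_le[of ?g "k - int n"]
    by (subst eq[of n]) (auto simp: norm_mult norm_power B_def intro!: mult_left_mono)
  moreover have "(\<lambda>n. norm p ^ n * B) \<longlonglongrightarrow> 0 * B"
    using p by (intro tendsto_intros LIMSEQ_power_zero) simp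
  ultimately have "norm (fourier_coeff ?g k) \<le> 0"
    by (intro LIMSEQ_le_const[of "\<lambda>n. norm p ^ n * B"]) auto
  then show ?thesis by simp
qed

lemma fourier_coeff_geom:
  assumes "norm p < 1"
  shows "fourier_coeff (geom p) k = (if k \<le> 0 then 0 else p ^ (nat k - 1))"
proof (cases "k \<le> 0")
  case True
  then show ?thesis
    using fourier_coeff_geom_mult_eq_0[OF assms, of "\<lambda>_. 1" 0 k]
    by (simp add: fourier_coeff_const integrable_circle_continuous)
next
  case False
  have rec: "fourier_coeff (geom p) (int n + 1) =
      fourier_coeff (\<lambda>_. 1) (int n) + p * fourier_coeff (geom p) (int n)" for n
    using fourier_coeff_geom_mult[OF assms, of "\<lambda>_. 1" "int n + 1"]
    by (simp add: integrable_circle_continuous)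
  have "fourier_coeff (geom p) (int n + 1) = p ^ n" for n
  proof (induction n)
    case 0
    then show ?case
      using rec[of 0] fourier_coeff_geom_mult_eq_0[OF assms, of "\<lambda>_. 1" 0 0]
      by (simp add: fourier_coeff_const integrable_circle_continuous)
  next
    case (Suc n)
    then show ?case
      using rec[of "Suc n"] by (simp add: fourier_coeff_const add.commute)
  qed
  from this[of "nat k - 1"] False show ?thesis
    by (simp add: nat_diff_distrib of_nat_diff)
qed

lemma integrable_geom: "norm p < 1 \<Longrightarrow> integrable circle (geom p)"
  by (intro integrable_circle_continuous continuous_on_geom)

lemma fourier_coeff_wfun:
  assumes "norm p < 1"
  shows "fourier_coeff (wfun b c p) k =
    (if k < 0 then 0 else if k = 0 then b else c * p ^ (nat k - 1))"
  unfolding wfun_def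
  by (simp add: fourier_coeff_add integrable_geom fourier_coeff_const fourier_coeff_cmult
      fourier_coeff_geom assms integrable_circle_continuous)

text \<open>The square of \<open>geom p\<close> starts at frequency 2 with coefficient 1, so the
  coefficients at 0, 1 and 2 form a triangular system for \<open>x\<close>, \<open>y\<close> and
  \<open>w\<close>. These three frequencies later identify the motion of the parameters.\<close>

lemma fourier_coeff_geom_quadratic:
  fixes p x y w :: complex
  assumes p: "norm p < 1"
  defines "g \<equiv> \<lambda>z. wfun x y p z + w * (geom p z)\<^sup>2"
  shows "k < 0 \<Longrightarrow> fourier_coeff g k = 0" "fourier_coeff g 0 = x" "fourier_coeff g 1 = y"
    "fourier_coeff g 2 = y * p + w"
proof -
  let ?s = "\<lambda>z. geom p z * geom p z"
  have i: "integrable circle ?s" "integrable circle (wfun x y p)"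
    by (intro integrable_circle_continuous continuous_intros continuous_on_geom continuous_on_wfun p)+
  have g: "fourier_coeff g k = fourier_coeff (wfun x y p) k + w * fourier_coeff ?s k" for k
    unfolding g_def power2_eq_square
    by (simp add: fourier_coeff_add fourier_coeff_cmult i)
  have s: "fourier_coeff ?s k = 0" if "k \<le> 1" for k
    by (rule fourier_coeff_geom_mult_eq_0[OF p integrable_geom[OF p] _ that])
      (simp add: fourier_coeff_geom p)
  have "fourier_coeff ?s 2 = 1"
    using fourier_coeff_geom_mult[OF p integrable_geom[OF p], of 2] s[of 1]
    by (simp add: fourier_coeff_geom p)
  then show "k < 0 \<Longrightarrow> fourier_coeff g k = 0" "fourier_coeff g 0 = x" "fourier_coeff g 1 = y"
    "fourier_coeff g 2 = y * p + w"
    using s by (simp_all add: g fourier_coeff_wfun p)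
qed

section \<open>Sobolev norms of functions with one pole\<close>

lemma L2_wfun: "norm p < 1 \<Longrightarrow> wfun b c p \<in> L2"
  by (intro L2_continuous continuous_on_wfun)

text \<open>Without negative frequencies the unordered sum over the integers becomes an ordinary
  series over the naturals, where comparison with geometric series is available.\<close>

lemma has_sum_Hs_weight:
  assumes neg: "\<And>k. k < 0 \<Longrightarrow> fourier_coeff f k = 0"
    and sm: "summable (\<lambda>n. Hs_weight s f (int n))"
  shows "(Hs_weight s f has_sum (\<Sum>n. Hs_weight s f (int n))) UNIV"
proof -
  have nn: "Hs_weight s f k \<ge> 0" for k
    by (simp add: Hs_weight_def)
  have "((\<lambda>n. Hs_weight s f (int n)) has_sum (\<Sum>n. Hs_weight s f (int n))) UNIV"
    using sm nn by (intro norm_summable_imp_has_sum summable_sums) simp_all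
  then have "(Hs_weight s f has_sum (\<Sum>n. Hs_weight s f (int n))) (range int)"
    by (subst has_sum_reindex) (simp_all add: o_def)
  then show ?thesis
  proof (rule has_sum_cong_neutral[THEN iffD1, rotated -1])
    fix k assume "k \<in> UNIV - range int"
    then have "k < 0" by (metis DiffD2 nonneg_int_cases not_less range_eqI)
    then show "Hs_weight s f k = 0"
      by (simp add: Hs_weight_def neg)
  qed auto
qed

lemma Hs_norm_eq:
  assumes "\<And>k. k < 0 \<Longrightarrow> fourier_coeff f k = 0" "summable (\<lambda>n. Hs_weight s f (int n))"
  shows "Hs_norm s f = sqrt (\<Sum>n. Hs_weight s f (int n))"
  using has_sum_Hs_weight[OF assms] by (simp add: Hs_norm_def infsumI)

lemma summable_Hs_geometric:
  fixes q :: real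
  assumes "0 \<le> q" "q < 1"
  shows "summable (\<lambda>n. (1 + (real n + 1)\<^sup>2) powr s * q ^ n)"
proof (cases "q = 0")
  case True
  then show ?thesis
    by (intro summable_finite[of "{0}"]) (auto simp: power_0_left)
next
  case False
  \<comment> \<open>Positive \<open>q\<close> is written as an exponential, whose decay beats every
    power weight. The case \<open>q = 0\<close>, where this fails, leaves only the term
    \<open>n = 0\<close>.\<close>
  define d where "d = - ln q"
  have d: "d > 0" and q: "q = exp (- d)"
    using assms False by (simp_all add: d_def)
  show ?thesis
  proof (rule summable_comparison_test_bigo)
    show "summable (\<lambda>n. norm (1 / real n ^ 2))"
      using inverse_power_summable[of 2, where 'a=real] by (simp add: inverse_eq_divide)
    have "(\<lambda>n. (1 + (real n + 1)\<^sup>2) powr s * exp (- d * real n)) \<in> O(\<lambda>n. 1 / real n ^ 2)"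
      using d by real_asymp
    moreover have "q ^ n = exp (- d * real n)" for n
      unfolding q by (simp add: exp_of_nat_mult[symmetric] mult.commute)
    ultimately show "(\<lambda>n. (1 + (real n + 1)\<^sup>2) powr s * q ^ n) \<in> O(\<lambda>n. 1 / real n ^ 2)"
      by simp
  qed
qed

lemma Hs_weight_wfun:
  assumes "norm p < 1"
  shows "Hs_weight s (wfun b c p) 0 = (norm b)\<^sup>2"
    and "Hs_weight s (wfun b c p) (int (Suc n)) =
      (norm c)\<^sup>2 * ((1 + (real n + 1)\<^sup>2) powr s * ((norm p)\<^sup>2) ^ n)"
proof -
  have "nat (1 + int n) - 1 = n" by simp
  then show "Hs_weight s (wfun b c p) 0 = (norm b)\<^sup>2"
    "Hs_weight s (wfun b c p) (int (Suc n)) =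
      (norm c)\<^sup>2 * ((1 + (real n + 1)\<^sup>2) powr s * ((norm p)\<^sup>2) ^ n)"
    by (simp_all add: Hs_weight_def fourier_coeff_wfun assms norm_mult norm_power
        power_mult_distrib power_mult[symmetric] mult_ac add_ac)
qed

lemma sums_Hs_weight_wfun:
  assumes "norm p < 1"
  shows "(\<lambda>n. Hs_weight s (wfun b c p) (int n)) sums
    ((norm b)\<^sup>2 + (norm c)\<^sup>2 * (\<Sum>n. (1 + (real n + 1)\<^sup>2) powr s * ((norm p)\<^sup>2) ^ n))"
proof -
  have "(norm p)\<^sup>2 < 1"
    using assms by (simp add: power_less_one_iff)
  then have "(\<lambda>n. Hs_weight s (wfun b c p) (int (Suc n))) sums
      ((norm c)\<^sup>2 * (\<Sum>n. (1 + (real n + 1)\<^sup>2) powr s * ((norm p)\<^sup>2) ^ n))"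
    unfolding Hs_weight_wfun(2)[OF assms]
    by (intro sums_mult summable_sums summable_Hs_geometric) simp_all
  then show ?thesis
    by (subst (asm) sums_Suc_iff) (simp add: Hs_weight_wfun(1)[OF assms] add.commute)
qed

lemma Hs_norm_wfun:
  assumes "norm p < 1"
  shows "Hs_norm s (wfun b c p) =
    sqrt ((norm b)\<^sup>2 + (norm c)\<^sup>2 * (\<Sum>n. (1 + (real n + 1)\<^sup>2) powr s * ((norm p)\<^sup>2) ^ n))"
  using sums_Hs_weight_wfun[OF assms, of s b c]
  by (subst Hs_norm_eq) (auto simp: fourier_coeff_wfun assms sums_iff)

lemma wfun_in_Hs:
  assumes "norm p < 1"
  shows "wfun b c p \<in> Hs s"
proof -
  have "(Hs_weight s (wfun b c p) has_sum (\<Sum>n. Hs_weight s (wfun b c p) (int n))) UNIV"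
    using sums_Hs_weight_wfun[OF assms, of s b c]
    by (intro has_sum_Hs_weight) (auto simp: fourier_coeff_wfun assms sums_iff)
  then show ?thesis
    by (auto simp: Hs_def L2_wfun assms has_sum_imp_summable)
qed

section \<open>Independence of the values off the circle, and the parameters of W(3)\<close>

lemma Hs_weight_cong:
  "(\<And>z. z \<in> sphere 0 1 \<Longrightarrow> f z = g z) \<Longrightarrow> Hs_weight s f = Hs_weight s g"
  using fourier_coeff_cong[of f g] by (auto simp: Hs_weight_def)

lemma Hs_norm_cong:
  "(\<And>z. z \<in> sphere 0 1 \<Longrightarrow> f z = g z) \<Longrightarrow> Hs_norm s f = Hs_norm s g"
  unfolding Hs_norm_def using Hs_weight_cong[of f g s] by simp

lemma L2_cong:
  assumes "\<And>z. z \<in> sphere 0 1 \<Longrightarrow> f z = g z"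
  shows "f \<in> L2 \<longleftrightarrow> g \<in> L2"
  unfolding L2_def using assms borel_measurable_circle_cong[of f g]
    Bochner_Integration.integrable_cong[of circle circle "\<lambda>z. (norm (f z))\<^sup>2" "\<lambda>z. (norm (g z))\<^sup>2"]
  by simp

lemma Hs_cong:
  "(\<And>z. z \<in> sphere 0 1 \<Longrightarrow> f z = g z) \<Longrightarrow> f \<in> Hs s \<longleftrightarrow> g \<in> Hs s"
  unfolding Hs_def using Hs_weight_cong[of f g s] L2_cong[of f g] by simp

text \<open>Splitting off the constant gives \<open>c = a + b * p\<close>. The absence of a common
  factor thereby becomes \<open>c \<noteq> 0\<close>, while \<open>a \<noteq> 0\<close> becomes
  \<open>c \<noteq> b * p\<close>.\<close>

lemma W3_iff:
  "u \<in> W3 \<longleftrightarrow> (\<exists>b c p. c \<noteq> 0 \<and> norm p < 1 \<and> c \<noteq> b * p \<and> (\<forall>z\<in>sphere 0 1. u z = wfun b c p z))"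
proof
  assume "u \<in> W3"
  then obtain a b p where *: "a \<noteq> 0" "norm p < 1" "a + b * p \<noteq> 0"
    and u: "\<And>z. z \<in> sphere 0 1 \<Longrightarrow> u z = (a * z + b) / (1 - p * z)"
    by (auto simp: W3_def)
  have "u z = wfun b (a + b * p) p z" if "z \<in> sphere 0 1" for z
    using u[OF that] one_minus_mult_neq_0[OF *(2), of z] that
    by (simp add: wfun_def geom_def divide_simps) (simp add: algebra_simps)
  then show "\<exists>b c p. c \<noteq> 0 \<and> norm p < 1 \<and> c \<noteq> b * p \<and> (\<forall>z\<in>sphere 0 1. u z = wfun b c p z)"
    using * by (intro exI[of _ b] exI[of _ "a + b * p"] exI[of _ p]) auto
next
  assume "\<exists>b c p. c \<noteq> 0 \<and> norm p < 1 \<and> c \<noteq> b * p \<and> (\<forall>z\<in>sphere 0 1. u z = wfun b c p z)"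
  then obtain b c p where *: "c \<noteq> 0" "norm p < 1" "c \<noteq> b * p"
    and u: "\<And>z. z \<in> sphere 0 1 \<Longrightarrow> u z = wfun b c p z"
    by blast
  have "u z = ((c - b * p) * z + b) / (1 - p * z)" if "z \<in> sphere 0 1" for z
    using u[OF that] one_minus_mult_neq_0[OF *(2), of z] that
    by (simp add: wfun_def geom_def divide_simps) (simp add: algebra_simps)
  then show "u \<in> W3"
    unfolding W3_def using *
    by (intro CollectI exI[of _ "c - b * p"] exI[of _ b] exI[of _ p]) auto
qed

section \<open>The equation on W(3) as an ordinary differential equation\<close>

definition pole_gap :: "complex \<Rightarrow> real" where
  "pole_gap p = 1 - (norm p)\<^sup>2"

text \<open>The squared L2 norm of \<open>c * geom p\<close>, as the geometric sum of the squared
  coefficients. By orthogonality, adding the square of \<open>norm b\<close> gives the squared L2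
  norm of \<open>wfun b c p\<close>, which is \<open>mass\<close>.\<close>

definition tail_mass :: "complex \<Rightarrow> complex \<Rightarrow> real" where
  "tail_mass c p = (norm c)\<^sup>2 / pole_gap p"

definition mass :: "complex \<Rightarrow> complex \<Rightarrow> complex \<Rightarrow> real" where
  "mass b c p = (norm b)\<^sup>2 + tail_mass c p"

text \<open>The value of \<open>wfun b c p\<close> at \<open>cnj p\<close>.\<close>

definition pole_value :: "complex \<Rightarrow> complex \<Rightarrow> complex \<Rightarrow> complex" where
  "pole_value b c p = b + c * cnj p / of_real (pole_gap p)"

text \<open>
  The equation reads \<open>\<i> b' = field_b\<close>, \<open>\<i> c' = field_c\<close>, \<open>\<i> p' = field_p\<close>. The three fields
  are the coefficients of the projected cubic term with respect to \<open>1\<close>, \<open>geom p\<close> and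
  \<open>c (geom p)\<^sup>2\<close>, the functions that appear in the derivative of \<open>wfun b c p\<close>.
\<close>

definition field_b :: "complex \<Rightarrow> complex \<Rightarrow> complex \<Rightarrow> complex" where
  "field_b b c p = of_real (mass b c p) * b + of_real (tail_mass c p) * pole_value b c p"

definition field_c :: "complex \<Rightarrow> complex \<Rightarrow> complex \<Rightarrow> complex" where
  "field_c b c p = of_real (mass b c p) * c + of_real (tail_mass c p) * p * pole_value b c p
     + b * c * cnj (pole_value b c p)"

definition field_p :: "complex \<Rightarrow> complex \<Rightarrow> complex \<Rightarrow> complex" where
  "field_p b c p = c * cnj (pole_value b c p)"

section \<open>The projection of the cubic term\<close>

lemma pole_gap_pos: "norm p < 1 \<Longrightarrow> pole_gap p > 0"
  by (simp add: pole_gap_def power_less_one_iff)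

lemma of_real_pole_gap: "complex_of_real (pole_gap p) = 1 - p * cnj p"
  unfolding pole_gap_def of_real_diff complex_norm_square by simp

lemma complex_norm_square: "complex_of_real ((norm z)\<^sup>2) = z * cnj z"
  by (rule complex_norm_square)

text \<open>From \<open>geom p z = z * (1 + p * geom p z)\<close> and \<open>z * cnj z = 1\<close>,
  the functions \<open>geom p z\<close> and \<open>1 + p * geom p z\<close> have equal modulus.
  Expanding the square of the latter and collecting the quadratic terms linearises the product; this
  is the relation that reduces the cubic term.\<close>

lemma geom_mult_cnj:
  assumes "norm p < 1" "norm z = 1"
  shows "(1 - p * cnj p) * (geom p z * cnj (geom p z)) = 1 + p * geom p z + cnj p * cnj (geom p z)"
proof -
  have nz: "1 - p * z \<noteq> 0" "1 - cnj p * cnj z \<noteq> 0"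
    using one_minus_mult_neq_0[of p z] one_minus_mult_neq_0[of "cnj p" "cnj z"] assms by simp_all
  have "z * cnj z = 1"
    using assms(2) by (simp add: complex_norm_square[symmetric])
  then have eq: "geom p z * cnj (geom p z) = (1 + p * geom p z) * (1 + cnj p * cnj (geom p z))"
    using nz by (simp add: geom_def divide_simps)
  show ?thesis
    using eq by algebra
qed

text \<open>The last summand has only negative frequencies, so the others are the projection.\<close>

lemma cubic_decomposition:
  assumes p: "norm p < 1" and z: "norm z = 1"
  shows "of_real ((norm (wfun b c p z))\<^sup>2) * wfun b c p z =
    wfun (field_b b c p) (field_c b c p) p z + c * field_p b c p * (geom p z)\<^sup>2
      + cnj c * (pole_value b c p)\<^sup>2 * cnj (geom p z)"
proof -
  \<comment> \<open>Each conjugate gets a name of its own. Treated as independent variables, they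
    make the claim a polynomial identity modulo the two relations \<open>R\<close> and
    \<open>vw\<close>.\<close>
  define v where "v = geom p z"
  define w where "w = cnj v"
  define q where "q = cnj p"
  define b' where "b' = cnj b"
  define c' where "c' = cnj c"
  define R where "R = inverse (1 - p * q)"
  have "complex_of_real (pole_gap p) \<noteq> 0"
    using pole_gap_pos[OF p] by simp
  then have R: "R * (1 - p * q) = 1"
    by (simp add: R_def q_def of_real_pole_gap)
  have "(1 - p * q) * (v * w) = 1 + p * v + q * w"
    using geom_mult_cnj[OF p z] by (simp add: v_def w_def q_def)
  then have vw: "v * w = R * (1 + p * v + q * w)"
    using R by algebra
  have "cnj R = R"
    by (simp add: R_def q_def mult.commute)
  moreover have W: "pole_value b c p = b + c * q * R"
    by (simp add: pole_value_def of_real_pole_gap R_def q_def divide_inverse)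
  ultimately have W': "cnj (pole_value b c p) = b' + c' * p * R"
    by (simp add: b'_def c'_def q_def)
  have N: "complex_of_real (tail_mass c p) = c * c' * R"
    unfolding tail_mass_def of_real_divide complex_norm_square of_real_pole_gap
    by (simp add: R_def q_def c'_def divide_inverse)
  have Q: "complex_of_real (mass b c p) = b * b' + c * c' * R"
    unfolding mass_def of_real_add N complex_norm_square by (simp add: b'_def)
  have "((b + c * v) * (b' + c' * w)) * (b + c * v) =
      (b * b' + c * c' * R) * b + c * c' * R * (b + c * q * R)
      + ((b * b' + c * c' * R) * c + c * c' * R * p * (b + c * q * R) + b * c * (b' + c' * p * R)) * v
      + c * (c * (b' + c' * p * R)) * v\<^sup>2 + c' * (b + c * q * R)\<^sup>2 * w"
    using vw R by algebra
  then show ?thesis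
    unfolding complex_norm_square wfun_def field_b_def field_c_def field_p_def W' N Q
    unfolding W
    by (simp add: v_def[symmetric] w_def[symmetric] b'_def c'_def q_def)
qed

text \<open>One candidate \<open>g\<close> shows that the choice in \<open>szego_proj\<close> is not
  vacuous. The difference of two candidates lies in the subspace and is orthogonal to it, hence to
  itself, so it vanishes almost everywhere.\<close>

lemma szego_proj_AE:
  assumes f: "f \<in> L2" and g: "g \<in> nonneg_freq L2"
    and orth: "\<And>h. h \<in> nonneg_freq L2 \<Longrightarrow> L2_inner (\<lambda>z. f z - g z) h = 0"
  shows "szego_proj f \<in> nonneg_freq L2" "AE z in circle. szego_proj f z = g z"
proof -
  define G where "G = szego_proj f"
  have "G \<in> nonneg_freq L2 \<and> (\<forall>h\<in>nonneg_freq L2. L2_inner (\<lambda>z. f z - G z) h = 0)"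
    unfolding G_def szego_proj_def by (rule someI[of _ g]) (use g orth in blast)
  then have G: "G \<in> nonneg_freq L2"
    and Gorth: "\<And>h. h \<in> nonneg_freq L2 \<Longrightarrow> L2_inner (\<lambda>z. f z - G z) h = 0"
    by blast+
  then show "szego_proj f \<in> nonneg_freq L2" by (simp add: G_def)
  define d where "d = (\<lambda>z. G z - g z)"
  have GL: "G \<in> L2" and gL: "g \<in> L2" using G g by (simp_all add: nonneg_freq_def)
  have dL: "d \<in> L2" unfolding d_def by (intro L2_diff GL gL)
  have d: "d \<in> nonneg_freq L2"
    using dL G g unfolding nonneg_freq_def d_def
    by (auto simp: fourier_coeff_diff L2_integrable)
  have "L2_inner (\<lambda>z. f z - g z) d - L2_inner (\<lambda>z. f z - G z) d = L2_inner d d"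
    unfolding L2_inner_def
    by (subst Bochner_Integration.integral_diff[symmetric])
      (auto intro!: integrable_L2_mult L2_diff L2_cnj f gL GL dL Bochner_Integration.integral_cong
        simp: d_def algebra_simps)
  then have "L2_inner d d = 0"
    using orth[OF d] Gorth[OF d] by simp
  moreover have "L2_inner d d = of_real (\<integral>z. (norm (d z))\<^sup>2 \<partial>circle)"
    unfolding L2_inner_def by (simp only: complex_norm_square[symmetric] integral_complex_of_real)
  ultimately have "(\<integral>z. (norm (d z))\<^sup>2 \<partial>circle) = 0"
    by simp
  moreover have "integrable circle (\<lambda>z. (norm (d z))\<^sup>2)"
    using dL by (simp add: L2_def)
  ultimately have "AE z in circle. (norm (d z))\<^sup>2 = 0"
    by (subst (asm) integral_nonneg_eq_0_iff_AE) auto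
  then show "AE z in circle. szego_proj f z = g z"
    by (simp add: d_def G_def)
qed

lemma fourier_coeff_cong_AE:
  assumes "AE z in circle. f z = g z" "f \<in> L2" "g \<in> L2"
  shows "fourier_coeff f k = fourier_coeff g k"
proof -
  have "integrable circle (\<lambda>z. f z * z powi (-k))" "integrable circle (\<lambda>z. g z * z powi (-k))"
    by (intro integrable_fourier_coeff L2_integrable assms)+
  then show ?thesis
    unfolding fourier_coeff_def using assms(1) by (intro integral_cong_AE) auto
qed

text \<open>The part of \<open>cubic_decomposition\<close> with nonnegative frequencies, hence a
  continuous representative of the projected cubic term.\<close>

definition szego_field :: "complex \<Rightarrow> complex \<Rightarrow> complex \<Rightarrow> complex \<Rightarrow> complex" where
  "szego_field b c p z =
     wfun (field_b b c p) (field_c b c p) p z + c * field_p b c p * (geom p z)\<^sup>2"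

lemma continuous_on_szego_field:
  "norm p < 1 \<Longrightarrow> continuous_on (sphere 0 1) (szego_field b c p)"
  unfolding szego_field_def by (intro continuous_intros continuous_on_wfun continuous_on_geom)

lemma szego_proj_cubic:
  assumes p: "norm p < 1" and u: "\<And>z. z \<in> sphere 0 1 \<Longrightarrow> u z = wfun b c p z"
  defines "P \<equiv> szego_proj (\<lambda>w. of_real ((norm (u w))\<^sup>2) * u w)"
  shows "P \<in> L2" "AE z in circle. P z = szego_field b c p z"
    "fourier_coeff P k = fourier_coeff (szego_field b c p) k"
proof -
  let ?f = "\<lambda>w. of_real ((norm (u w))\<^sup>2) * u w"
  let ?g = "szego_field b c p"
  have gL: "?g \<in> L2"
    by (intro L2_continuous continuous_on_szego_field p)
  have g: "?g \<in> nonneg_freq L2"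
    unfolding nonneg_freq_def using gL fourier_coeff_geom_quadratic(1)[OF p]
    by (auto simp: szego_field_def[abs_def])
  have "(\<lambda>w. of_real ((norm (wfun b c p w))\<^sup>2) * wfun b c p w) \<in> L2"
    by (intro L2_continuous continuous_intros continuous_on_wfun p)
  then have f: "?f \<in> L2"
    using L2_cong[of ?f "\<lambda>w. of_real ((norm (wfun b c p w))\<^sup>2) * wfun b c p w"] u by simp
  have orth: "L2_inner (\<lambda>z. ?f z - ?g z) h = 0" if h: "h \<in> nonneg_freq L2" for h
  proof -
    \<comment> \<open>The pairing of the remainder with \<open>h\<close> is the conjugate of the
      mean of \<open>k * (geom p z * h z)\<close>. Since \<open>h\<close> has no negative
      frequencies, multiplication by \<open>geom p\<close> leaves nothing at frequency 0.\<close>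
    define k where "k = c * (cnj (pole_value b c p))\<^sup>2"
    have "L2_inner (\<lambda>z. ?f z - ?g z) h = (\<integral>z. cnj (k * (geom p z * h z)) \<partial>circle)"
      unfolding L2_inner_def
    proof (intro Bochner_Integration.integral_cong refl)
      fix z assume z: "z \<in> space circle"
      then have "?f z - ?g z = cnj k * cnj (geom p z)"
        using cubic_decomposition[OF p, of z b c] u[of z] by (simp add: szego_field_def k_def)
      then show "(?f z - ?g z) * cnj (h z) = cnj (k * (geom p z * h z))"
        by simp
    qed
    also have "\<dots> = cnj (k * (\<integral>z. geom p z * h z \<partial>circle))"
      by (simp only: Bochner_Integration.integral_cnj integral_mult_right_zero)
    also have "(\<integral>z. geom p z * h z \<partial>circle) = fourier_coeff (\<lambda>z. geom p z * h z) 0"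
      by (simp add: fourier_coeff_def)
    also have "\<dots> = 0"
      using h by (intro fourier_coeff_geom_mult_eq_0[OF p, of _ 0])
        (auto simp: nonneg_freq_def L2_integrable)
    finally show ?thesis by simp
  qed
  from szego_proj_AE[OF f g orth] show P: "P \<in> L2" "AE z in circle. P z = ?g z"
    by (simp_all add: P_def nonneg_freq_def)
  then show "fourier_coeff P k = fourier_coeff ?g k"
    by (intro fourier_coeff_cong_AE gL)
qed

section \<open>From the equation to the differential equation for the parameters\<close>

lemma has_vector_derivative_iff_quotient:
  fixes f :: "real \<Rightarrow> complex"
  shows "(f has_vector_derivative f') (at t) \<longleftrightarrow>
    ((\<lambda>h. (f (t + h) - f t) / of_real h - f') \<longlongrightarrow> 0) (at 0)"
proof -
  have "norm (f (t + h) - f t - h *\<^sub>R f') / norm h = norm ((f (t + h) - f t) / of_real h - f')"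
    if "h \<noteq> 0" for h
  proof -
    have "(f (t + h) - f t) / of_real h - f' = (f (t + h) - f t - h *\<^sub>R f') / of_real h"
      using that by (simp add: field_simps scaleR_conv_of_real)
    then show ?thesis by (simp add: norm_divide)
  qed
  then have "((\<lambda>h. norm (f (t + h) - f t - h *\<^sub>R f') / norm h) \<longlongrightarrow> 0) (at 0) \<longleftrightarrow>
      ((\<lambda>h. norm ((f (t + h) - f t) / of_real h - f')) \<longlongrightarrow> 0) (at 0)"
    by (intro tendsto_cong) (auto simp: eventually_at_filter)
  then show ?thesis
    unfolding has_vector_derivative_def has_derivative_at
    by (simp add: tendsto_norm_zero_iff bounded_linear_scaleR_left)
qed

text \<open>Coefficients are contractions on L2, so the L2 limit of the difference quotients passes
  to every single frequency as a classical derivative.\<close>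

lemma has_vector_derivative_fourier_coeff:
  assumes u: "\<And>t. u t \<in> L2" and v: "v \<in> L2" and d: "has_L2_derivative u v t"
  shows "((\<lambda>t. fourier_coeff (u t) k) has_vector_derivative fourier_coeff v k) (at t)"
  unfolding has_vector_derivative_iff_quotient
proof (rule Lim_null_comparison)
  show "((\<lambda>h. L2_norm (\<lambda>z. (u (t + h) z - u t z) / of_real h - v z)) \<longlongrightarrow> 0) (at 0)"
    using d by (simp add: has_L2_derivative_def)
  have "norm ((fourier_coeff (u (t + h)) k - fourier_coeff (u t) k) / of_real h - fourier_coeff v k)
      \<le> L2_norm (\<lambda>z. (u (t + h) z - u t z) / of_real h - v z)" for h
  proof -
    have q: "(\<lambda>z. (u (t + h) z - u t z) / of_real h) \<in> L2"
      using L2_cmult[OF L2_diff[OF u u], of "1 / of_real h" "t + h" t] by simp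
    have "fourier_coeff (\<lambda>z. (u (t + h) z - u t z) / of_real h - v z) k =
        (fourier_coeff (u (t + h)) k - fourier_coeff (u t) k) / of_real h - fourier_coeff v k"
      by (simp add: fourier_coeff_diff fourier_coeff_divide L2_integrable q u v)
    then show ?thesis
      using norm_fourier_coeff_le_L2_norm[OF L2_diff[OF q v], of k] by simp
  qed
  then show "\<forall>\<^sub>F h in at 0. norm ((fourier_coeff (u (t + h)) k - fourier_coeff (u t) k) / of_real h
      - fourier_coeff v k) \<le> L2_norm (\<lambda>z. (u (t + h) z - u t z) / of_real h - v z)"
    by simp
qed

text \<open>The side conditions are those of \<open>W3_iff\<close>, so that the curve stays in
  W(3).\<close>

definition szego_ode :: "(real \<Rightarrow> complex) \<Rightarrow> (real \<Rightarrow> complex) \<Rightarrow> (real \<Rightarrow> complex) \<Rightarrow> bool" where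
  "szego_ode b c p \<longleftrightarrow> (\<forall>t. norm (p t) < 1 \<and> c t \<noteq> 0 \<and> c t \<noteq> b t * p t \<and>
     (b has_vector_derivative - \<i> * field_b (b t) (c t) (p t)) (at t) \<and>
     (c has_vector_derivative - \<i> * field_c (b t) (c t) (p t)) (at t) \<and>
     (p has_vector_derivative - \<i> * field_p (b t) (c t) (p t)) (at t))"

lemma has_vector_derivative_divide_complex:
  fixes f g :: "real \<Rightarrow> complex"
  assumes f: "(f has_vector_derivative f') (at t)" and g: "(g has_vector_derivative g') (at t)"
    and nz: "g t \<noteq> 0"
  shows "((\<lambda>t. f t / g t) has_vector_derivative (f' * g t - f t * g') / (g t)\<^sup>2) (at t)"
proof -
  have "(inverse has_field_derivative - inverse (g t ^ 2)) (at (g t))"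
    using DERIV_inverse[OF nz] by (simp add: power2_eq_square)
  from field_vector_diff_chain_at[OF g this]
  have "((\<lambda>t. inverse (g t)) has_vector_derivative g' * - inverse (g t ^ 2)) (at t)"
    by (simp add: o_def)
  from has_vector_derivative_mult[OF f this] show ?thesis
    using nz by (auto simp: divide_simps power2_eq_square elim!: has_vector_derivative_eq_rhs)
qed

text \<open>The parameters are first chosen separately at each time, with no regularity in
  \<open>t\<close>. It is recovered from the Fourier coefficients at 0, 1 and 2, which are
  \<open>b\<close>, \<open>c\<close> and \<open>c * p\<close> and are differentiable; then
  \<open>p\<close> is a quotient with nonvanishing denominator \<open>c\<close>.\<close>

lemma szego_solution_on_W3_imp_ode:
  assumes "szego_solution_on_W3 u"
  obtains b c p where "szego_ode b c p"
    and "\<And>t z. z \<in> sphere 0 1 \<Longrightarrow> u t z = wfun (b t) (c t) (p t) z"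
proof -
  have "\<forall>t. \<exists>b c p. c \<noteq> 0 \<and> norm p < 1 \<and> c \<noteq> b * p \<and> (\<forall>z\<in>sphere 0 1. u t z = wfun b c p z)"
    using assms by (simp add: szego_solution_on_W3_def W3_iff)
  then obtain b c p where nz: "\<And>t. c t \<noteq> 0" and p: "\<And>t. norm (p t) < 1"
    and a: "\<And>t. c t \<noteq> b t * p t"
    and u: "\<And>t z. z \<in> sphere 0 1 \<Longrightarrow> u t z = wfun (b t) (c t) (p t) z"
    by metis
  define P where "P = (\<lambda>t. szego_proj (\<lambda>w. of_real ((norm (u t w))\<^sup>2) * u t w))"
  have sol: "u t \<in> L2" "has_L2_derivative u (\<lambda>z. - \<i> * P t z) t" for t
    using assms by (auto simp: szego_solution_on_W3_def szego_solution_def nonneg_freq_def Hs_def P_def)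
  have PL: "P t \<in> L2" and
    Pc: "fourier_coeff (P t) k = fourier_coeff (szego_field (b t) (c t) (p t)) k" for t k
    using szego_proj_cubic[OF p u] by (simp_all add: P_def)
  have der: "((\<lambda>t. fourier_coeff (wfun (b t) (c t) (p t)) k) has_vector_derivative
      - \<i> * fourier_coeff (szego_field (b t) (c t) (p t)) k) (at t)" for t k
  proof -
    have "fourier_coeff (u t) k = fourier_coeff (wfun (b t) (c t) (p t)) k" for t
      using u by (rule fourier_coeff_cong)
    then show ?thesis
      using has_vector_derivative_fourier_coeff[OF sol(1) L2_cmult[OF PL] sol(2)[of t], of k]
      by (simp only: fourier_coeff_cmult Pc)
  qed
  have fc: "fourier_coeff (szego_field (b t) (c t) (p t)) 0 = field_b (b t) (c t) (p t)"
    "fourier_coeff (szego_field (b t) (c t) (p t)) 1 = field_c (b t) (c t) (p t)"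
    "fourier_coeff (szego_field (b t) (c t) (p t)) 2 =
      field_c (b t) (c t) (p t) * p t + c t * field_p (b t) (c t) (p t)" for t
    using fourier_coeff_geom_quadratic[OF p] by (simp_all add: szego_field_def[abs_def])
  have b': "(b has_vector_derivative - \<i> * field_b (b t) (c t) (p t)) (at t)" for t
    using der[of 0 t] by (simp add: fourier_coeff_wfun p fc)
  have c': "(c has_vector_derivative - \<i> * field_c (b t) (c t) (p t)) (at t)" for t
    using der[of 1 t] by (simp add: fourier_coeff_wfun p fc)
  have "((\<lambda>t. c t * p t) has_vector_derivative
      - \<i> * (field_c (b t) (c t) (p t) * p t + c t * field_p (b t) (c t) (p t))) (at t)" for t
    using der[of 2 t] by (simp add: fourier_coeff_wfun p fc)
  from has_vector_derivative_divide_complex[OF this c' nz]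
  have "(p has_vector_derivative - \<i> * field_p (b t) (c t) (p t)) (at t)" for t
    using nz by (auto simp: divide_simps power2_eq_square algebra_simps elim!: has_vector_derivative_eq_rhs)
  with b' c' nz p a have "szego_ode b c p"
    by (simp add: szego_ode_def)
  with u show ?thesis using that by blast
qed

section \<open>Conservation laws and boundedness\<close>

text \<open>In this form a part of \<open>f'\<close> that is a real multiple of \<open>f t\<close>
  contributes nothing, so the large real terms of the fields drop out of the rates below.\<close>

lemma has_real_derivative_norm_sq:
  fixes f :: "real \<Rightarrow> complex"
  assumes "(f has_vector_derivative - \<i> * f') (at t)"
  shows "((\<lambda>t. (norm (f t))\<^sup>2) has_real_derivative 2 * Im (cnj (f t) * f')) (at t)"
proof -
  have "((\<lambda>t. f t * cnj (f t)) has_vector_derivative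
      f t * cnj (- \<i> * f') + (- \<i> * f') * cnj (f t)) (at t)"
    by (intro derivative_intros assms)
  from bounded_linear.has_vector_derivative[OF bounded_linear_Re this]
  show ?thesis
    by (simp add: has_real_derivative_iff_has_vector_derivative complex_norm_square[symmetric]
        algebra_simps del: of_real_power)
qed

text \<open>This is Pythagoras. With \<open>a = c - b * p\<close>, the function is the sum of
  \<open>a * (z - cnj p) / (1 - p * z)\<close>, a multiple of a Blaschke factor of unit norm, and of
  \<open>pole_gap p * pole_value b c p / (1 - p * z)\<close>. The latter is a multiple of the
  reproducing kernel at \<open>cnj p\<close>, whose squared norm is \<open>1 / pole_gap p\<close>,
  and the former vanishes at \<open>cnj p\<close>.\<close>

lemma mass_minus_norm_sq:
  assumes "norm p < 1"
  shows "mass b c p - (norm (c - b * p))\<^sup>2 = pole_gap p * (norm (pole_value b c p))\<^sup>2"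
proof -
  define R where "R = inverse (1 - p * cnj p)"
  have "complex_of_real (pole_gap p) \<noteq> 0"
    using pole_gap_pos[OF assms] by simp
  then have R: "R * (1 - p * cnj p) = 1"
    by (simp add: R_def of_real_pole_gap)
  have cR: "cnj R = R"
    by (simp add: R_def mult.commute)
  have "complex_of_real (mass b c p - (norm (c - b * p))\<^sup>2) =
      b * cnj b + c * cnj c * R - (c - b * p) * (cnj c - cnj b * cnj p)"
    unfolding mass_def tail_mass_def of_real_diff of_real_add of_real_divide complex_norm_square
      of_real_pole_gap
    by (simp add: R_def divide_inverse)
  also have "\<dots> = (1 - p * cnj p) * ((b + c * cnj p * R) * (cnj b + cnj c * p * R))"
    using R by algebra
  also have "\<dots> = complex_of_real (pole_gap p * (norm (pole_value b c p))\<^sup>2)"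
    unfolding of_real_mult complex_norm_square pole_value_def of_real_pole_gap
    by (simp add: divide_inverse R_def[symmetric] cR)
  finally show ?thesis
    by (simp only: of_real_eq_iff)
qed

text \<open>Each product is a real number plus a real multiple of \<open>p * b * cnj c\<close> or of
  its conjugate. The squared moduli of \<open>b\<close>, \<open>c\<close> and \<open>p\<close> are
  therefore all driven by the same \<open>\<theta>\<close>, and eliminating it produces the
  conserved quantities.\<close>

lemma Im_cnj_mult_fields:
  defines "\<theta> \<equiv> \<lambda>b c p. Im (p * b * cnj c)"
  shows "Im (cnj b * field_b b c p) = - tail_mass c p / pole_gap p * \<theta> b c p"
    and "Im (cnj c * field_c b c p) = 2 * tail_mass c p * \<theta> b c p"
    and "Im (cnj p * field_p b c p) = - \<theta> b c p"
proof -
  let ?r = "pole_gap p"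
  have *: "cnj b * field_b b c p = of_real (mass b c p * (norm b)\<^sup>2 + tail_mass c p * (norm b)\<^sup>2)
      + of_real (tail_mass c p / ?r) * cnj (p * b * cnj c)"
    unfolding of_real_add of_real_mult complex_norm_square field_b_def pole_value_def
    by (simp add: algebra_simps)
  show "Im (cnj b * field_b b c p) = - tail_mass c p / ?r * \<theta> b c p"
    unfolding * \<theta>_def by (simp add: algebra_simps diff_divide_distrib add_divide_distrib)
  have *: "cnj c * field_c b c p = of_real (mass b c p * (norm c)\<^sup>2
        + tail_mass c p * (norm c)\<^sup>2 * (norm p)\<^sup>2 / ?r + (norm c)\<^sup>2 * (norm b)\<^sup>2)
      + of_real (tail_mass c p + (norm c)\<^sup>2 / ?r) * (p * b * cnj c)"
    unfolding of_real_add of_real_mult of_real_divide complex_norm_square field_c_def pole_value_def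
    by (simp add: algebra_simps add_divide_distrib)
  show "Im (cnj c * field_c b c p) = 2 * tail_mass c p * \<theta> b c p"
    unfolding * \<theta>_def by (simp add: tail_mass_def algebra_simps diff_divide_distrib add_divide_distrib)
  have *: "cnj p * field_p b c p = of_real ((norm c)\<^sup>2 * (norm p)\<^sup>2 / ?r) + cnj (p * b * cnj c)"
    unfolding of_real_mult of_real_divide complex_norm_square field_p_def pole_value_def
    by (simp add: algebra_simps)
  show "Im (cnj p * field_p b c p) = - \<theta> b c p"
    unfolding * \<theta>_def by (simp add: algebra_simps diff_divide_distrib add_divide_distrib)
qed

lemma szego_ode_conserved:
  assumes "szego_ode b c p"
  shows "mass (b t) (c t) (p t) = mass (b 0) (c 0) (p 0)"
    and "(norm (c t))\<^sup>2 / (pole_gap (p t))\<^sup>2 = (norm (c 0))\<^sup>2 / (pole_gap (p 0))\<^sup>2"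
    and "(norm (c t - b t * p t))\<^sup>2 = (norm (c 0 - b 0 * p 0))\<^sup>2"
proof -
  define r where "r t = pole_gap (p t)" for t
  define \<theta> where "\<theta> t = Im (p t * b t * cnj (c t))" for t
  have r: "r t > 0" for t
    using assms by (simp add: r_def szego_ode_def pole_gap_pos)
  have b': "(b has_vector_derivative - \<i> * field_b (b t) (c t) (p t)) (at t)"
    and c': "(c has_vector_derivative - \<i> * field_c (b t) (c t) (p t)) (at t)"
    and p': "(p has_vector_derivative - \<i> * field_p (b t) (c t) (p t)) (at t)" for t
    using assms by (auto simp: szego_ode_def)
  define nb where "nb t = (norm (b t))\<^sup>2" for t
  define nc where "nc t = (norm (c t))\<^sup>2" for t
  note der = has_real_derivative_norm_sq[OF b', unfolded Im_cnj_mult_fields, folded nb_def r_def \<theta>_def]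
    has_real_derivative_norm_sq[OF c', unfolded Im_cnj_mult_fields, folded nc_def r_def \<theta>_def]
    has_real_derivative_norm_sq[OF p', unfolded Im_cnj_mult_fields, folded r_def \<theta>_def]
  have nb': "(nb has_real_derivative - 2 * nc t / (r t)\<^sup>2 * \<theta> t) (at t)" for t
    using der(1)[of t] by (rule DERIV_cong) (simp add: tail_mass_def nc_def r_def power2_eq_square)
  have nc': "(nc has_real_derivative 4 * nc t / r t * \<theta> t) (at t)" for t
    using der(2)[of t] by (rule DERIV_cong) (simp add: tail_mass_def nc_def r_def)
  have r': "(r has_real_derivative 2 * \<theta> t) (at t)" for t
    using DERIV_diff[OF DERIV_const[of 1] der(3)[of t]]
    by (simp add: r_def[abs_def] pole_gap_def)
  \<comment> \<open>The logarithmic derivative of \<open>nc\<close> is twice that of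
    \<open>r\<close>.\<close>
  have "((\<lambda>t. nc t / (r t)\<^sup>2) has_real_derivative 0) (at t)" for t
    using r[of t]
    by (auto simp: field_simps power2_eq_square intro!: derivative_eq_intros nc' r')
  from DERIV_isconst_all[OF allI[OF this], of t 0]
  show "(norm (c t))\<^sup>2 / (pole_gap (p t))\<^sup>2 = (norm (c 0))\<^sup>2 / (pole_gap (p 0))\<^sup>2"
    unfolding r_def nc_def .
  have "((\<lambda>t. nb t + nc t / r t) has_real_derivative 0) (at t)" for t
    using r[of t]
    by (auto simp: field_simps power2_eq_square intro!: derivative_eq_intros nb' nc' r')
  from DERIV_isconst_all[OF allI[OF this], of t 0]
  show "mass (b t) (c t) (p t) = mass (b 0) (c 0) (p 0)"
    unfolding r_def nb_def nc_def mass_def tail_mass_def .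
  \<comment> \<open>All terms with \<open>pole_value\<close> cancel, and
    \<open>a = c - b * p\<close> merely rotates, with angular velocity given by the mass.\<close>
  have "((\<lambda>t. c t - b t * p t) has_vector_derivative
      - \<i> * (of_real (mass (b t) (c t) (p t)) * (c t - b t * p t))) (at t)" for t
    using has_vector_derivative_diff[OF c' has_vector_derivative_mult[OF b' p']]
    by (rule has_vector_derivative_eq_rhs)
      (simp add: field_b_def field_c_def field_p_def algebra_simps)
  from has_real_derivative_norm_sq[OF this]
  have "((\<lambda>t. (norm (c t - b t * p t))\<^sup>2) has_real_derivative 0) (at t)" for t
    by (simp add: algebra_simps)
  from DERIV_isconst_all[OF allI[OF this], of t 0]
  show "(norm (c t - b t * p t))\<^sup>2 = (norm (c 0 - b 0 * p 0))\<^sup>2" .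
qed

section \<open>The lower bound for the gap and the boundedness of the norms\<close>

lemma norm_pole_value_le:
  assumes "norm p < 1"
  shows "norm (pole_value b c p) \<le> sqrt (mass b c p) + sqrt ((norm c)\<^sup>2 / (pole_gap p)\<^sup>2)"
proof -
  note r = pole_gap_pos[OF assms]
  have "norm (pole_value b c p) \<le> norm b + norm (c * cnj p / of_real (pole_gap p))"
    unfolding pole_value_def by (rule norm_triangle_ineq)
  also have "norm (c * cnj p / of_real (pole_gap p)) \<le> norm c / pole_gap p"
    using r assms by (simp add: norm_divide norm_mult divide_right_mono mult_left_le)
  also have "norm c / pole_gap p = sqrt ((norm c)\<^sup>2 / (pole_gap p)\<^sup>2)"
    using r by (simp add: real_sqrt_divide)
  also have "norm b \<le> sqrt (mass b c p)"
    using r by (intro real_le_rsqrt) (simp add: mass_def tail_mass_def)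
  finally show ?thesis by simp
qed

lemma szego_ode_pole_gap_bounded_below:
  assumes ode: "szego_ode b c p"
  obtains r0 where "r0 > 0" "\<And>t. pole_gap (p t) \<ge> r0"
proof -
  have p: "norm (p t) < 1" for t
    using ode by (simp add: szego_ode_def)
  define Q where "Q = mass (b 0) (c 0) (p 0)"
  define M where "M = (norm (c 0))\<^sup>2 / (pole_gap (p 0))\<^sup>2"
  define G where "G = Q - (norm (c 0 - b 0 * p 0))\<^sup>2"
  have G: "G = pole_gap (p t) * (norm (pole_value (b t) (c t) (p t)))\<^sup>2" for t
    using mass_minus_norm_sq[OF p, of "b t" "c t" t] szego_ode_conserved(1,3)[OF ode, of t]
    by (simp add: G_def Q_def)
  show ?thesis
  proof (cases "G = 0")
    case True
    have "(p has_vector_derivative 0) (at t)" for t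
    proof -
      have "pole_value (b t) (c t) (p t) = 0"
        using G[of t] True pole_gap_pos[OF p, of t] by simp
      then show ?thesis
        using ode by (auto simp: szego_ode_def field_p_def dest!: spec[of _ t])
    qed
    then have "p t = p 0" for t
      using has_vector_derivative_zero_constant[of UNIV p] by (metis UNIV_I convex_UNIV)
    then show ?thesis
      using that[of "pole_gap (p 0)"] pole_gap_pos[OF p, of 0] by (metis order_refl)
  next
    case False
    define K where "K = sqrt Q + sqrt M"
    have K: "norm (pole_value (b t) (c t) (p t)) \<le> K" for t
      using norm_pole_value_le[OF p, of "b t" "c t" t] szego_ode_conserved(1,2)[OF ode, of t]
      by (simp add: K_def Q_def M_def)
    have le: "G \<le> pole_gap (p t) * K\<^sup>2" for t
      unfolding G[of t] using pole_gap_pos[OF p, of t] K[of t]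
      by (intro mult_left_mono power_mono) simp_all
    have "G > 0"
      using False G[of 0] pole_gap_pos[OF p, of 0] by (simp add: less_le)
    then have "K\<^sup>2 > 0"
      using le[of 0] by (cases "K = 0") auto
    then show ?thesis
      using that[of "G / K\<^sup>2"] \<open>G > 0\<close> le by (simp add: pos_divide_le_eq)
  qed
qed

text \<open>A gap of at least \<open>r0\<close> makes the squared Fourier coefficients decay at the
  uniform rate \<open>1 - r0\<close>, which absorbs the weight for any \<open>s\<close>. The
  conserved mass and momentum bound \<open>b\<close> and \<open>c\<close>.\<close>

lemma szego_solution_on_W3_bounded:
  assumes "szego_solution_on_W3 u"
  shows "u t \<in> Hs s" "bdd_above (range (\<lambda>t. Hs_norm s (u t)))"
proof -
  obtain b c p where ode: "szego_ode b c p"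
    and u: "\<And>t z. z \<in> sphere 0 1 \<Longrightarrow> u t z = wfun (b t) (c t) (p t) z"
    using szego_solution_on_W3_imp_ode[OF assms] by blast
  have p: "norm (p t) < 1" for t
    using ode by (simp add: szego_ode_def)
  show "u t \<in> Hs s"
    using Hs_cong[of "u t" "wfun (b t) (c t) (p t)" s] u wfun_in_Hs[OF p] by simp
  obtain r0 where r0: "r0 > 0" "\<And>t. pole_gap (p t) \<ge> r0"
    using szego_ode_pole_gap_bounded_below[OF ode] by blast
  define Q where "Q = mass (b 0) (c 0) (p 0)"
  define M where "M = (norm (c 0))\<^sup>2 / (pole_gap (p 0))\<^sup>2"
  have M: "M \<ge> 0" by (simp add: M_def)
  let ?S = "\<lambda>q. \<Sum>n. (1 + (real n + 1)\<^sup>2) powr s * q ^ n"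
  have q: "0 \<le> 1 - r0" "1 - r0 < 1"
    using r0(1) order_trans[OF r0(2)[of 0], of 1] by (simp_all add: pole_gap_def)
  have "Hs_norm s (u t) \<le> sqrt (Q + M * ?S (1 - r0))" for t
  proof -
    note r = pole_gap_pos[OF p, of t]
    have "?S ((norm (p t))\<^sup>2) \<le> ?S (1 - r0)"
      using r0(2)[of t] r q
      by (intro suminf_le summable_Hs_geometric mult_left_mono power_mono)
        (simp_all add: pole_gap_def)
    moreover have "(norm (b t))\<^sup>2 \<le> Q"
      using szego_ode_conserved(1)[OF ode, of t] r by (simp add: Q_def mass_def tail_mass_def)
        (smt (verit) divide_nonneg_pos zero_le_power2)
    moreover have "(norm (c t))\<^sup>2 \<le> M"
    proof -
      have "(norm (c t))\<^sup>2 = M * (pole_gap (p t))\<^sup>2"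
        using szego_ode_conserved(2)[OF ode, of t] r by (simp add: M_def field_simps)
      also have "\<dots> \<le> M * 1"
        using r by (intro mult_left_mono power_le_one) (simp_all add: M_def pole_gap_def)
      finally show ?thesis by simp
    qed
    moreover have "?S ((norm (p t))\<^sup>2) \<ge> 0"
      using r by (intro suminf_nonneg summable_Hs_geometric) (simp_all add: pole_gap_def)
    moreover have "Hs_norm s (u t) = Hs_norm s (wfun (b t) (c t) (p t))"
      using u by (rule Hs_norm_cong)
    ultimately show ?thesis
      using M by (auto simp: Hs_norm_wfun[OF p] intro!: add_mono mult_mono)
  qed
  then show "bdd_above (range (\<lambda>t. Hs_norm s (u t)))"
    by (intro bdd_aboveI2)
qed

section \<open>From the differential equation to solutions\<close>

lemma has_vector_derivative_imp_tendsto: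
  fixes f :: "real \<Rightarrow> complex"
  assumes "(f has_vector_derivative f') (at t)"
  shows "((\<lambda>h. f (t + h)) \<longlongrightarrow> f t) (at 0)" "(f \<longlongrightarrow> f t) (at t)"
  using has_vector_derivative_continuous[OF assms] isCont_iff[of t f] isCont_def[of t f] by auto

text \<open>The bound does not depend on \<open>z\<close>, so the L2 norm of the error is controlled
  by the parameters alone.\<close>

lemma norm_le_diff_quotient_wfun:
  assumes p: "norm p0 < 1" "norm p1 < 1" and z: "norm z = 1" and h: "h \<noteq> 0"
  defines "V0 \<equiv> 1 / (1 - norm p0)" and "V1 \<equiv> 1 / (1 - norm p1)"
  shows "norm ((wfun b1 c1 p1 z - wfun b0 c0 p0 z) / h -
      (wfun b' c' p0 z + c0 * p' * (geom p0 z)\<^sup>2)) \<le>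
    norm ((b1 - b0) / h - b') + norm ((c1 - c0) / h - c') * V0
    + norm (c1 * ((p1 - p0) / h) - c0 * p') * (V1 * V0)
    + norm (c0 * p' * (p1 - p0)) * (V0 * (V1 * V0))"
proof -
  define v0 where "v0 = geom p0 z"
  define v1 where "v1 = geom p1 z"
  have v: "norm v0 \<le> V0" "norm v1 \<le> V1"
    unfolding v0_def v1_def V0_def V1_def by (intro norm_geom_le p z)+
  have V: "V0 \<ge> 0" "V1 \<ge> 0"
    using p by (simp_all add: V0_def V1_def)
  have d: "v1 - v0 = (p1 - p0) * (v1 * v0)"
    unfolding v0_def v1_def by (rule geom_diff[OF p(2,1) z])
  have "(wfun b1 c1 p1 z - wfun b0 c0 p0 z) / h - (wfun b' c' p0 z + c0 * p' * (geom p0 z)\<^sup>2) =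
      ((b1 - b0) / h - b') + ((c1 - c0) / h - c') * v0 + (c1 * (v1 - v0) / h - c0 * p' * v0\<^sup>2)"
    using h by (simp add: wfun_def v0_def v1_def field_simps)
  \<comment> \<open>The resolvent identity extracts the difference quotient of the pole. It comes
    with \<open>v1 * v0\<close> instead of the square of \<open>v0\<close>, and the second summand
    corrects this.\<close>
  also have "c1 * (v1 - v0) / h - c0 * p' * v0\<^sup>2 =
      (c1 * ((p1 - p0) / h) - c0 * p') * (v1 * v0) + c0 * p' * v0 * (v1 - v0)"
    unfolding d by (simp add: algebra_simps power2_eq_square)
      (use d in algebra)
  also have "c0 * p' * v0 * (v1 - v0) = c0 * p' * (p1 - p0) * (v0 * (v1 * v0))"
    unfolding d by (simp add: mult_ac)
  finally have eq: "(wfun b1 c1 p1 z - wfun b0 c0 p0 z) / h - (wfun b' c' p0 z + c0 * p' * (geom p0 z)\<^sup>2) =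
      ((b1 - b0) / h - b') + ((c1 - c0) / h - c') * v0
      + ((c1 * ((p1 - p0) / h) - c0 * p') * (v1 * v0) + c0 * p' * (p1 - p0) * (v0 * (v1 * v0)))" .
  have v10: "norm v1 * norm v0 \<le> V1 * V0"
    using v V by (intro mult_mono) simp_all
  have v010: "norm v0 * (norm v1 * norm v0) \<le> V0 * (V1 * V0)"
    using v V v10 by (intro mult_mono) simp_all
  have "norm ((wfun b1 c1 p1 z - wfun b0 c0 p0 z) / h
        - (wfun b' c' p0 z + c0 * p' * (geom p0 z)\<^sup>2)) \<le>
      (norm ((b1 - b0) / h - b') + norm ((c1 - c0) / h - c') * V0)
      + (norm (c1 * ((p1 - p0) / h) - c0 * p') * (V1 * V0)
        + norm (c0 * p' * (p1 - p0)) * (V0 * (V1 * V0)))"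
    unfolding eq
    by (intro norm_triangle_mono order_refl; simp only: norm_mult[of _ v0] norm_mult[of _ "v1 * v0"]
        norm_mult[of _ "v0 * (v1 * v0)"] norm_mult[of v1] norm_mult[of v0] norm_mult[of v0 "v1 * v0"];
        intro mult_left_mono v v10 v010 norm_ge_zero)
  then show ?thesis by simp
qed

lemma has_L2_derivative_wfun:
  assumes p: "\<And>t. norm (p t) < 1"
    and b': "(b has_vector_derivative b') (at t)"
    and c': "(c has_vector_derivative c') (at t)"
    and p': "(p has_vector_derivative p') (at t)"
  shows "has_L2_derivative (\<lambda>t. wfun (b t) (c t) (p t))
    (\<lambda>z. wfun b' c' (p t) z + c t * p' * (geom (p t) z)\<^sup>2) t"
proof -
  define V where "V t = 1 / (1 - norm (p t))" for t
  define E where "E h = norm ((b (t + h) - b t) / of_real h - b')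
    + norm ((c (t + h) - c t) / of_real h - c') * V t
    + norm (c (t + h) * ((p (t + h) - p t) / of_real h) - c t * p') * (V (t + h) * V t)
    + norm (c t * p' * (p (t + h) - p t)) * (V t * (V (t + h) * V t))" for h
  let ?F = "\<lambda>h z. (wfun (b (t + h)) (c (t + h)) (p (t + h)) z - wfun (b t) (c t) (p t) z) / of_real h
    - (wfun b' c' (p t) z + c t * p' * (geom (p t) z)\<^sup>2)"
  have "V t \<ge> 0" for t
    using p[of t] by (simp add: V_def)
  then have E0: "E h \<ge> 0" for h
    by (simp add: E_def)
  have "((\<lambda>h. (p (t + h) - p t) / of_real h) \<longlongrightarrow> p') (at 0)"
    using p' by (simp add: has_vector_derivative_iff_quotient LIM_zero_iff)
  moreover have "((\<lambda>h. V (t + h)) \<longlongrightarrow> V t) (at 0)"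
    using p[of t] unfolding V_def by (intro tendsto_intros has_vector_derivative_imp_tendsto(1)[OF p']) simp
  ultimately have "(E \<longlongrightarrow> norm (0::complex) + norm (0::complex) * V t
      + norm (c t * p' - c t * p') * (V t * V t) + norm (c t * p' * (p t - p t)) * (V t * (V t * V t))) (at 0)"
    unfolding E_def
    by (intro tendsto_intros has_vector_derivative_imp_tendsto(1)[OF c'] has_vector_derivative_imp_tendsto(1)[OF p']
        b'[unfolded has_vector_derivative_iff_quotient] c'[unfolded has_vector_derivative_iff_quotient])
  then have E: "(E \<longlongrightarrow> 0) (at 0)" by simp
  have bound: "L2_norm (?F h) \<le> E h" if "h \<noteq> 0" for h
  proof (rule L2_norm_le)
    show "?F h \<in> L2"
      using that by (intro L2_continuous continuous_intros continuous_on_wfun continuous_on_geom p) simp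
    show "norm (?F h z) \<le> E h" if "z \<in> sphere 0 1" for z
      using norm_le_diff_quotient_wfun[of "p t" "p (t + h)" z "of_real h" "b (t + h)" "c (t + h)"
          "b t" "c t" b' c' p'] p that \<open>h \<noteq> 0\<close> by (simp add: E_def V_def)
  qed (rule E0)
  show ?thesis
    unfolding has_L2_derivative_def
  proof (rule Lim_null_comparison[OF _ E])
    show "\<forall>\<^sub>F h in at 0. norm (L2_norm (?F h)) \<le> E h"
      using bound by (auto simp: eventually_at_filter L2_norm_def intro!: always_eventually)
  qed
qed

text \<open>Each frequency converges by continuity of the parameters. The limit passes through the
  series by Tannery's theorem, with a geometric majorant valid near \<open>t\<close>.\<close>

lemma Hs_norm_wfun_diff_tendsto:
  assumes p: "\<And>t. norm (p t) < 1" and b0: "(b \<longlongrightarrow> b t) (at t)" and c0: "(c \<longlongrightarrow> c t) (at t)"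
    and p0: "(p \<longlongrightarrow> p t) (at (t::real))"
  shows "((\<lambda>\<tau>. Hs_norm s (\<lambda>z. wfun (b \<tau>) (c \<tau>) (p \<tau>) z - wfun (b t) (c t) (p t) z)) \<longlongrightarrow> 0) (at t)"
proof -
  define D where "D \<tau> z = wfun (b \<tau>) (c \<tau>) (p \<tau>) z - wfun (b t) (c t) (p t) z" for \<tau> z
  have fc: "fourier_coeff (D \<tau>) k =
      fourier_coeff (wfun (b \<tau>) (c \<tau>) (p \<tau>)) k - fourier_coeff (wfun (b t) (c t) (p t)) k" for \<tau> k
    unfolding D_def by (intro fourier_coeff_diff L2_integrable L2_wfun p)
  define A where "A n \<tau> = (1 + (real n + 1)\<^sup>2) powr s * (norm (c \<tau> * p \<tau> ^ n - c t * p t ^ n))\<^sup>2" for n \<tau>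
  have w0: "Hs_weight s (D \<tau>) 0 = (norm (b \<tau> - b t))\<^sup>2" for \<tau>
    by (simp add: Hs_weight_def fc fourier_coeff_wfun p)
  have "nat (1 + int n) - 1 = n" for n by simp
  then have wS: "Hs_weight s (D \<tau>) (int (Suc n)) = A n \<tau>" for \<tau> n
    by (simp add: Hs_weight_def fc fourier_coeff_wfun p A_def add_ac)
  \<comment> \<open>Halfway between \<open>norm (p t)\<close> and 1: it exceeds
    \<open>norm (p \<tau>)\<close> for \<open>\<tau>\<close> near \<open>t\<close> and still leaves
    a convergent majorant.\<close>
  define \<rho> where "\<rho> = (1 + norm (p t)) / 2"
  define K where "K = norm (c t) + 1"
  have \<rho>: "norm (p t) < \<rho>" "\<rho> < 1" "0 \<le> \<rho>"
    using p[of t] norm_ge_zero[of "p t"] by (simp_all add: \<rho>_def)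
  have "\<forall>\<^sub>F \<tau> in at t. norm (p \<tau>) < \<rho>"
    using order_tendstoD(2)[OF tendsto_norm[OF p0] \<rho>(1)] .
  moreover have "\<forall>\<^sub>F \<tau> in at t. norm (c \<tau>) < K"
    using order_tendstoD(2)[OF tendsto_norm[OF c0], of K] by (simp add: K_def)
  ultimately have ev: "\<forall>\<^sub>F \<tau> in at t. norm (p \<tau>) < \<rho> \<and> norm (c \<tau>) < K"
    by (rule eventually_conj)
  define M where "M n = (2 * K)\<^sup>2 * ((1 + (real n + 1)\<^sup>2) powr s * (\<rho>\<^sup>2) ^ n)" for n
  have M: "norm (A n \<tau>) \<le> M n" if "norm (p \<tau>) < \<rho> \<and> norm (c \<tau>) < K" for n \<tau>
  proof -
    have "norm (c \<tau> * p \<tau> ^ n - c t * p t ^ n) \<le> norm (c \<tau> * p \<tau> ^ n) + norm (c t * p t ^ n)"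
      by (rule norm_triangle_ineq4)
    also have "\<dots> \<le> K * \<rho> ^ n + K * \<rho> ^ n"
      unfolding norm_mult norm_power using that \<rho>(1)
      by (intro add_mono mult_mono power_mono) (simp_all add: K_def)
    finally have "(norm (c \<tau> * p \<tau> ^ n - c t * p t ^ n))\<^sup>2 \<le> (2 * K * \<rho> ^ n)\<^sup>2"
      by (intro power_mono) simp_all
    also have "\<dots> = (2 * K)\<^sup>2 * (\<rho>\<^sup>2) ^ n"
      by (simp add: power_mult_distrib power_mult[symmetric] mult.commute)
    finally show ?thesis
      unfolding A_def M_def by (subst mult.left_commute) (simp add: mult_left_mono)
  qed
  have "\<rho>\<^sup>2 < 1" using \<rho> by (simp add: power_less_one_iff)
  then have sM: "summable M"
    unfolding M_def by (intro summable_mult summable_Hs_geometric) simp_all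
  have lim: "((\<lambda>\<tau>. A n \<tau>) \<longlongrightarrow> 0) (at t)" for n
  proof -
    have "((\<lambda>\<tau>. A n \<tau>) \<longlongrightarrow> (1 + (real n + 1)\<^sup>2) powr s * (norm (c t * p t ^ n - c t * p t ^ n))\<^sup>2) (at t)"
      unfolding A_def by (intro tendsto_intros c0 p0)
    then show ?thesis by simp
  qed
  have "\<forall>\<^sub>F (n, \<tau>) in at_top \<times>\<^sub>F at t. norm (A n \<tau>) \<le> M n"
    by (rule eventually_mono[OF eventually_prodI[OF eventually_True ev]])
      (simp add: case_prod_beta M[unfolded real_norm_def])
  from tannerys_theorem[OF lim this sM]
  have sumA: "\<forall>\<^sub>F \<tau> in at t. summable (\<lambda>n. A n \<tau>)"
    and limA: "((\<lambda>\<tau>. \<Sum>n. A n \<tau>) \<longlongrightarrow> 0) (at t)"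
    by (auto elim!: eventually_mono intro: summable_norm_cancel)
  have eq: "Hs_norm s (D \<tau>) = sqrt ((norm (b \<tau> - b t))\<^sup>2 + (\<Sum>n. A n \<tau>))"
    if "summable (\<lambda>n. A n \<tau>)" for \<tau>
  proof -
    have "(\<lambda>n. Hs_weight s (D \<tau>) (int (Suc n))) sums (\<Sum>n. A n \<tau>)"
      unfolding wS using that by (rule summable_sums)
    then have "(\<lambda>n. Hs_weight s (D \<tau>) (int n)) sums ((norm (b \<tau> - b t))\<^sup>2 + (\<Sum>n. A n \<tau>))"
      by (subst (asm) sums_Suc_iff) (simp add: w0 add.commute)
    then show ?thesis
      by (subst Hs_norm_eq) (auto simp: fc fourier_coeff_wfun p sums_iff)
  qed
  have "((\<lambda>\<tau>. sqrt ((norm (b \<tau> - b t))\<^sup>2 + (\<Sum>n. A n \<tau>))) \<longlongrightarrow> sqrt ((norm (b t - b t))\<^sup>2 + 0)) (at t)"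
    by (intro tendsto_intros b0 limA)
  then have "((\<lambda>\<tau>. sqrt ((norm (b \<tau> - b t))\<^sup>2 + (\<Sum>n. A n \<tau>))) \<longlongrightarrow> 0) (at t)"
    by simp
  then have "((\<lambda>\<tau>. Hs_norm s (D \<tau>)) \<longlongrightarrow> 0) (at t)"
    by (rule Lim_transform_eventually) (use sumA in \<open>auto elim!: eventually_mono simp: eq\<close>)
  then show ?thesis by (simp add: D_def[abs_def])
qed

text \<open>Passes from the explicit field to the representative that \<open>szego_proj\<close>
  happens to choose.\<close>

lemma has_L2_derivative_cong_AE:
  assumes "has_L2_derivative u v t" "AE z in circle. v z = w z"
    and u: "\<And>t. u t \<in> L2" and vw: "v \<in> L2" "w \<in> L2"
  shows "has_L2_derivative u w t"
proof -
  have "L2_norm (\<lambda>z. (u (t + h) z - u t z) / of_real h - v z) =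
      L2_norm (\<lambda>z. (u (t + h) z - u t z) / of_real h - w z)" for h
  proof (rule L2_norm_cong_AE)
    have q: "(\<lambda>z. (u (t + h) z - u t z) / of_real h) \<in> L2"
      using L2_cmult[OF L2_diff[OF u u], of "1 / of_real h" "t + h" t] by simp
    show "(\<lambda>z. (u (t + h) z - u t z) / of_real h - v z) \<in> borel_measurable circle"
      "(\<lambda>z. (u (t + h) z - u t z) / of_real h - w z) \<in> borel_measurable circle"
      using L2_diff[OF q vw(1)] L2_diff[OF q vw(2)] by (simp_all add: L2_def)
    show "AE z in circle. (u (t + h) z - u t z) / of_real h - v z = (u (t + h) z - u t z) / of_real h - w z"
      using assms(2) by eventually_elim simp
  qed
  then show ?thesis using assms(1) by (simp add: has_L2_derivative_def)
qed

lemma szego_ode_imp_solution_on_W3: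
  assumes ode: "szego_ode b c p"
  shows "szego_solution_on_W3 (\<lambda>t. wfun (b t) (c t) (p t))"
  unfolding szego_solution_on_W3_def szego_solution_def
proof (intro conjI allI)
  fix t
  have p: "norm (p t) < 1" "c t \<noteq> 0" "c t \<noteq> b t * p t"
    and b': "(b has_vector_derivative - \<i> * field_b (b t) (c t) (p t)) (at t)"
    and c': "(c has_vector_derivative - \<i> * field_c (b t) (c t) (p t)) (at t)"
    and p': "(p has_vector_derivative - \<i> * field_p (b t) (c t) (p t)) (at t)" for t
    using ode by (auto simp: szego_ode_def)
  show "wfun (b t) (c t) (p t) \<in> W3"
    unfolding W3_iff using p by blast
  show "wfun (b t) (c t) (p t) \<in> nonneg_freq (Hs (1/2))"
    using p by (auto simp: nonneg_freq_def wfun_in_Hs fourier_coeff_wfun)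
  show "((\<lambda>\<tau>. Hs_norm (1/2) (\<lambda>z. wfun (b \<tau>) (c \<tau>) (p \<tau>) z - wfun (b t) (c t) (p t) z)) \<longlongrightarrow> 0) (at t)"
    by (intro Hs_norm_wfun_diff_tendsto p has_vector_derivative_imp_tendsto(2)[OF b'] has_vector_derivative_imp_tendsto(2)[OF c']
        has_vector_derivative_imp_tendsto(2)[OF p'])
  let ?P = "szego_proj (\<lambda>w. of_real ((norm (wfun (b t) (c t) (p t) w))\<^sup>2) * wfun (b t) (c t) (p t) w)"
  have P: "?P \<in> L2" "AE z in circle. ?P z = szego_field (b t) (c t) (p t) z"
    using szego_proj_cubic(1,2)[OF p(1), of "wfun (b t) (c t) (p t)" "b t" "c t" t] by simp_all
  have d: "has_L2_derivative (\<lambda>t. wfun (b t) (c t) (p t)) (\<lambda>z. - \<i> * szego_field (b t) (c t) (p t) z) t"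
    using has_L2_derivative_wfun[OF p(1) b' c' p', of t]
    by (simp add: szego_field_def wfun_def algebra_simps)
  show "has_L2_derivative (\<lambda>t. wfun (b t) (c t) (p t)) (\<lambda>z. - \<i> * ?P z) t"
  proof (rule has_L2_derivative_cong_AE[OF d])
    show "AE z in circle. - \<i> * szego_field (b t) (c t) (p t) z = - \<i> * ?P z"
      using P(2) by eventually_elim simp
  qed (intro L2_wfun L2_cmult P p L2_continuous[OF continuous_on_szego_field])+
qed

section \<open>A family with growing Sobolev norms\<close>

text \<open>
  The solution with datum \<open>z + 2e\<close>, from the explicit formula of Gerard and Grellier: the Hankel
  operator of the datum is the matrix with rows \<open>(2e, 1)\<close> and \<open>(1, 0)\<close>, and
  \<open>family_freq e\<close> is half the difference of the eigenvalues of its square.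
\<close>

definition family_phase1 :: "real \<Rightarrow> real \<Rightarrow> complex" where
  "family_phase1 e t = cis (- 2 * e\<^sup>2 * t)"

definition family_phase2 :: "real \<Rightarrow> real \<Rightarrow> complex" where
  "family_phase2 e t = cis (- (1 + 2 * e\<^sup>2) * t)"

definition family_freq :: "real \<Rightarrow> real" where
  "family_freq e = 2 * e * sqrt (1 + e\<^sup>2)"

text \<open>A square root of the gap: its squared modulus is \<open>pole_gap (family_p e t)\<close>.
  As \<open>family_c\<close> is its square up to phases, the momentum equals 1 at all times.\<close>

definition family_m :: "real \<Rightarrow> real \<Rightarrow> complex" where
  "family_m e t = of_real (cos (family_freq e * t))
     - \<i> * (of_real (e / sqrt (1 + e\<^sup>2)) * of_real (sin (family_freq e * t)))"

definition family_b :: "real \<Rightarrow> real \<Rightarrow> complex" where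
  "family_b e t = family_phase2 e t * (of_real (2 * e) * of_real (cos (family_freq e * t))
     - \<i> * (of_real ((1 + 2 * e\<^sup>2) / sqrt (1 + e\<^sup>2)) * of_real (sin (family_freq e * t))))"

definition family_c :: "real \<Rightarrow> real \<Rightarrow> complex" where
  "family_c e t = family_phase1 e t * family_phase2 e t * (family_m e t * family_m e t)"

definition family_p :: "real \<Rightarrow> real \<Rightarrow> complex" where
  "family_p e t = - \<i> * (of_real (1 / sqrt (1 + e\<^sup>2)) * (family_phase1 e t * of_real (sin (family_freq e * t))))"

section \<open>Verification of the explicit solution\<close>

lemma pole_gap_family: "pole_gap (family_p e t) = 1 - (sin (family_freq e * t))\<^sup>2 / (1 + e\<^sup>2)"
  by (simp add: pole_gap_def family_p_def family_phase1_def norm_mult norm_divide power_mult_distrib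
      power_divide add_nonneg_nonneg)

lemma norm_family_p_less_1:
  assumes "e \<noteq> 0"
  shows "norm (family_p e t) < 1"
proof -
  have "(sin (family_freq e * t))\<^sup>2 < 1 + e\<^sup>2"
    using assms sin_cos_squared_add[of "family_freq e * t"] zero_le_power2[of "cos (family_freq e * t)"]
      zero_less_power2[of e] by linarith
  then have "pole_gap (family_p e t) > 0"
    using assms by (simp add: pole_gap_family divide_simps add_pos_nonneg)
  then show ?thesis
    by (simp add: pole_gap_def power_less_one_iff)
qed

text \<open>Along the family the gap and the tail mass both equal \<open>m * n\<close>, the mass is
  \<open>1 + 4 * x\<^sup>2\<close> and the pole value is \<open>2 * x * E2 / n\<close>. All
  denominators then cancel in the fields, and only trigonometric polynomials have to be
  compared.\<close>

lemma family_ode: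
  assumes e: "e \<noteq> 0"
  shows "szego_ode (family_b e) (family_c e) (family_p e)"
  unfolding szego_ode_def
proof (intro allI)
  fix t
  define d where "d = sqrt (1 + e\<^sup>2)"
  have d: "d\<^sup>2 = 1 + e\<^sup>2" "d > 0"
    by (simp_all add: d_def add_pos_nonneg)
  define x where "x = complex_of_real e"
  define R where "R = complex_of_real (1 / d)"
  define D where "D = complex_of_real d"
  define C where "C = complex_of_real (cos (family_freq e * t))"
  define S where "S = complex_of_real (sin (family_freq e * t))"
  define E1 where "E1 = family_phase1 e t"
  define E2 where "E2 = family_phase2 e t"
  define F1 where "F1 = cnj E1"
  define F2 where "F2 = cnj E2"
  define m where "m = family_m e t"
  define n where "n = cnj m"
  define b where "b = family_b e t"
  define c where "c = family_c e t"
  define p where "p = family_p e t"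
  have E: "E1 * F1 = 1" "E2 * F2 = 1"
    by (simp_all add: F1_def F2_def E1_def E2_def family_phase1_def family_phase2_def
        complex_norm_square[symmetric])
  have CS: "C\<^sup>2 + S\<^sup>2 = 1"
    unfolding C_def S_def by (metis of_real_1 of_real_add of_real_power sin_cos_squared_add2)
  have DR: "D * R = 1" using d(2) by (simp add: D_def R_def)
  have DD: "D\<^sup>2 = 1 + x\<^sup>2"
    unfolding D_def x_def using d(1) by (metis of_real_1 of_real_add of_real_power)
  have "R * (D * D) = R * (1 + x\<^sup>2)" using DD by (simp add: power2_eq_square)
  then have D_eq: "D = R * (1 + x\<^sup>2)"
    using DR by (simp add: mult_ac)
  \<comment> \<open>The relations are stated as vanishing expressions. Several identities below
    write the difference of their two sides as an explicit combination of these, which leaves a mere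
    expansion.\<close>
  have z: "E1 * F1 - 1 = 0" "E2 * F2 - 1 = 0" "C\<^sup>2 + S\<^sup>2 - 1 = 0" "R * D - 1 = 0"
      "D - R * (1 + x\<^sup>2) = 0" "R\<^sup>2 * (1 + x\<^sup>2) - 1 = 0"
    using E CS DR D_eq by (simp_all add: mult_ac power2_eq_square)
  have m_eq: "m = C - \<i> * (x * R * S)"
    by (simp add: m_def family_m_def d_def[symmetric] R_def x_def C_def S_def)
  have n_eq: "n = C + \<i> * (x * R * S)"
    by (simp add: n_def m_eq x_def R_def S_def C_def)
  have b_eq: "b = E2 * (2 * x * C - \<i> * ((1 + 2 * x\<^sup>2) * R * S))"
    by (simp add: b_def family_b_def d_def[symmetric] R_def x_def C_def S_def E2_def)
  have b'_eq: "cnj b = F2 * (2 * x * C + \<i> * ((1 + 2 * x\<^sup>2) * R * S))"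
    by (simp add: b_eq F2_def x_def C_def R_def S_def)
  have c_eq: "c = E1 * E2 * (m * m)"
    by (simp add: c_def family_c_def m_def E1_def E2_def)
  have p_eq: "p = - \<i> * (R * (E1 * S))"
    by (simp add: p_def family_p_def d_def[symmetric] R_def S_def E1_def)
  have q_eq: "cnj p = \<i> * (R * (F1 * S))"
    by (simp add: p_eq F1_def R_def S_def)
  have p: "norm p < 1"
    unfolding p_def using e by (rule norm_family_p_less_1)
  have mn: "1 - p * cnj p = m * n"
  proof -
    have "1 - p * cnj p - m * n = - (C\<^sup>2 + S\<^sup>2 - 1) - R\<^sup>2 * S\<^sup>2 * (E1 * F1 - 1)
        - S\<^sup>2 * (R\<^sup>2 * (1 + x\<^sup>2) - 1)"
      unfolding q_eq unfolding p_eq m_eq n_eq by (simp add: algebra_simps power2_eq_square)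
    then show ?thesis unfolding z by simp
  qed
  have gap: "complex_of_real (pole_gap p) = m * n"
    by (simp add: of_real_pole_gap mn)
  moreover have "complex_of_real (pole_gap p) \<noteq> 0"
    using pole_gap_pos[OF p] by simp
  ultimately have nz: "m \<noteq> 0" "n \<noteq> 0" by auto
  have Wn: "b * n + E1 * E2 * m * cnj p = 2 * x * E2"
  proof -
    have "b * n + E1 * E2 * m * cnj p - 2 * x * E2 =
        E2 * (2 * x * (C\<^sup>2 + S\<^sup>2 - 1) + 2 * x * S\<^sup>2 * (R\<^sup>2 * (1 + x\<^sup>2) - 1)
          + \<i> * R * S * m * (E1 * F1 - 1))"
      unfolding b_eq q_eq m_eq n_eq by (simp add: algebra_simps power2_eq_square)
    then show ?thesis unfolding z by simp
  qed
  have W: "pole_value b c p = 2 * x * E2 / n"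
  proof -
    have "pole_value b c p * n = b * n + E1 * E2 * m * cnj p"
      using nz by (simp add: pole_value_def gap c_eq field_simps)
    then show ?thesis
      unfolding Wn using nz(2) by (simp add: eq_divide_eq)
  qed
  have W': "cnj (pole_value b c p) = 2 * x * F2 / m"
    by (simp add: W x_def F2_def n_def)
  have N: "complex_of_real (tail_mass c p) = m * n"
  proof -
    have "c * cnj c = (E1 * F1) * (E2 * F2) * ((m * n) * (m * n))"
      by (simp add: c_eq F1_def F2_def n_def)
    then show ?thesis
      unfolding tail_mass_def of_real_divide complex_norm_square gap using E nz by simp
  qed
  have Q: "complex_of_real (mass b c p) = 1 + 4 * x\<^sup>2"
  proof -
    have "b * cnj b + m * n - (1 + 4 * x\<^sup>2) =
        (4 * x\<^sup>2 * C\<^sup>2 + (1 + 2 * x\<^sup>2)\<^sup>2 * R\<^sup>2 * S\<^sup>2) * (E2 * F2 - 1)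
        + (1 + 4 * x\<^sup>2) * (C\<^sup>2 + S\<^sup>2 - 1) + S\<^sup>2 * (1 + 4 * x\<^sup>2) * (R\<^sup>2 * (1 + x\<^sup>2) - 1)"
      unfolding b'_eq unfolding b_eq m_eq n_eq by (simp add: algebra_simps power2_eq_square)
    then show ?thesis
      unfolding mass_def of_real_add complex_norm_square N z by simp
  qed
  have fp: "field_p b c p = 2 * x * E1 * m"
    unfolding field_p_def W' using nz E by (simp add: c_eq)
  have fb: "field_b b c p = (1 + 4 * x\<^sup>2) * b + 2 * x * E2 * m"
    unfolding field_b_def W Q N using nz by simp
  have fc: "field_c b c p = (1 + 4 * x\<^sup>2) * c + 2 * x * E2 * m * p + 2 * x * E1 * m * b"
    unfolding field_c_def W' Q N unfolding W using nz E by (simp add: c_eq)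
  have w: "complex_of_real (family_freq e) = 2 * x * D"
    by (simp add: family_freq_def x_def D_def d_def)
  have "((\<lambda>t. family_freq e * t) has_real_derivative family_freq e) (at t)"
    by (auto intro!: derivative_eq_intros)
  then have trig: "((\<lambda>t. cos (family_freq e * t)) has_real_derivative - sin (family_freq e * t) * family_freq e) (at t)"
    "((\<lambda>t. sin (family_freq e * t)) has_real_derivative cos (family_freq e * t) * family_freq e) (at t)"
    by (auto intro!: derivative_eq_intros)
  have C': "((\<lambda>t. complex_of_real (cos (family_freq e * t))) has_vector_derivative - S * (2 * x * D)) (at t)"
    by (rule has_vector_derivative_eq_rhs[OF has_vector_derivative_of_real[OF trig(1)]])
      (simp add: w S_def)
  have S': "((\<lambda>t. complex_of_real (sin (family_freq e * t))) has_vector_derivative C * (2 * x * D)) (at t)"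
    by (rule has_vector_derivative_eq_rhs[OF has_vector_derivative_of_real[OF trig(2)]])
      (simp add: w C_def)
  have "((\<lambda>t. - 2 * e\<^sup>2 * t) has_real_derivative - 2 * e\<^sup>2) (at t)"
    "((\<lambda>t. - (1 + 2 * e\<^sup>2) * t) has_real_derivative - (1 + 2 * e\<^sup>2)) (at t)"
    by (auto intro!: derivative_eq_intros)
  note this[THEN has_vector_derivative_cis]
  then have E1': "(family_phase1 e has_vector_derivative - 2 * x\<^sup>2 * \<i> * E1) (at t)"
    and E2': "(family_phase2 e has_vector_derivative - (1 + 2 * x\<^sup>2) * \<i> * E2) (at t)"
    by (simp_all add: family_phase1_def[abs_def] family_phase2_def[abs_def] x_def E1_def E2_def)
  have "- S * (2 * x * D) - \<i> * (x * R * (C * (2 * x * D)))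
      - (- \<i> * (2 * x\<^sup>2 * C) - 2 * x * (1 + x\<^sup>2) * R * S)
      = - 2 * x * S * (D - R * (1 + x\<^sup>2)) - 2 * \<i> * x\<^sup>2 * C * (R * D - 1)"
    by (simp add: algebra_simps power2_eq_square)
  then have m'_eq: "- S * (2 * x * D) - \<i> * (x * R * (C * (2 * x * D))) =
      - \<i> * (2 * x\<^sup>2 * C) - 2 * x * (1 + x\<^sup>2) * R * S"
    unfolding z by simp
  have "complex_of_real (e / d) = x * R"
    by (simp add: x_def R_def)
  then have m': "(family_m e has_vector_derivative - \<i> * (2 * x\<^sup>2 * C) - 2 * x * (1 + x\<^sup>2) * R * S) (at t)"
    unfolding family_m_def[abs_def]
    by (intro has_vector_derivative_eq_rhs[OF has_vector_derivative_diff[OF C'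
          has_vector_derivative_mult_right[OF has_vector_derivative_mult_right[OF S']]]])
      (simp only: d_def[symmetric] m'_eq)
  have b': "(family_b e has_vector_derivative - \<i> * field_b b c p) (at t)"
    unfolding family_b_def[abs_def]
  proof (rule has_vector_derivative_eq_rhs[OF has_vector_derivative_mult[OF E2'
          has_vector_derivative_diff[OF has_vector_derivative_mult_right[OF C']
            has_vector_derivative_mult_right[OF has_vector_derivative_mult_right[OF S']]]]],
      fold d_def C_def S_def E2_def)
    show "E2 * (of_real (2 * e) * (- S * (2 * x * D))
          - \<i> * (of_real ((1 + 2 * e\<^sup>2) / d) * (C * (2 * x * D))))
        + - (1 + 2 * x\<^sup>2) * \<i> * E2 * (of_real (2 * e) * C - \<i> * (of_real ((1 + 2 * e\<^sup>2) / d) * S))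
        = - \<i> * field_b b c p"
    proof -
      have coeffs: "complex_of_real ((1 + 2 * e\<^sup>2) / d) = (1 + 2 * x\<^sup>2) * R" "complex_of_real (2 * e) = 2 * x"
        by (simp_all add: x_def R_def)
      have "E2 * (2 * x * (- S * (2 * x * D)) - \<i> * ((1 + 2 * x\<^sup>2) * R * (C * (2 * x * D))))
            + - (1 + 2 * x\<^sup>2) * \<i> * E2 * (2 * x * C - \<i> * ((1 + 2 * x\<^sup>2) * R * S))
            - - \<i> * field_b b c p =
          E2 * (- \<i> * (1 + 2 * x\<^sup>2) * 2 * x * C * (R * D - 1) - 4 * x\<^sup>2 * S * (D - R * (1 + x\<^sup>2)))"
        unfolding fb unfolding b_eq m_eq by (simp add: algebra_simps power2_eq_square)
      also have "\<dots> = 0"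
        unfolding z by simp
      finally show ?thesis
        unfolding coeffs by (simp only: right_minus_eq)
    qed
  qed
  have c': "(family_c e has_vector_derivative - \<i> * field_c b c p) (at t)"
    unfolding family_c_def[abs_def]
  proof (rule has_vector_derivative_eq_rhs[OF has_vector_derivative_mult[OF
          has_vector_derivative_mult[OF E1' E2'] has_vector_derivative_mult[OF m' m']]],
      fold E1_def E2_def m_def)
    show "E1 * E2 * (m * (- \<i> * (2 * x\<^sup>2 * C) - 2 * x * (1 + x\<^sup>2) * R * S)
          + (- \<i> * (2 * x\<^sup>2 * C) - 2 * x * (1 + x\<^sup>2) * R * S) * m)
        + (E1 * (- (1 + 2 * x\<^sup>2) * \<i> * E2) + - 2 * x\<^sup>2 * \<i> * E1 * E2) * (m * m)
        = - \<i> * field_c b c p"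
      unfolding fc unfolding c_eq b_eq p_eq by (simp add: algebra_simps power2_eq_square)
  qed
  have p': "(family_p e has_vector_derivative - \<i> * field_p b c p) (at t)"
    unfolding family_p_def[abs_def]
  proof (rule has_vector_derivative_eq_rhs[OF has_vector_derivative_mult_right[OF
          has_vector_derivative_mult_right[OF has_vector_derivative_mult[OF E1' S']]]],
      fold d_def R_def S_def E1_def)
    show "- \<i> * (R * (E1 * (C * (2 * x * D)) + - 2 * x\<^sup>2 * \<i> * E1 * S)) = - \<i> * field_p b c p"
    proof -
      have "- \<i> * (R * (E1 * (C * (2 * x * D)) + - 2 * x\<^sup>2 * \<i> * E1 * S)) - - \<i> * field_p b c p =
          - \<i> * E1 * 2 * x * C * (R * D - 1)"
        unfolding fp m_eq by (simp add: algebra_simps power2_eq_square)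
      then show ?thesis unfolding z by simp
    qed
  qed
  \<comment> \<open>By \<open>mass_minus_norm_sq\<close> the modulus of \<open>a = c - b * p\<close>
    is 1 throughout, so the curve never leaves W(3).\<close>
  have "(norm (c - b * p))\<^sup>2 = 1 + 4 * e\<^sup>2 - (2 * e)\<^sup>2"
  proof -
    have "pole_gap p * (norm (pole_value b c p))\<^sup>2 = (2 * e)\<^sup>2"
    proof -
      have "complex_of_real (pole_gap p * (norm (pole_value b c p))\<^sup>2) = (2 * x) * (2 * x) * (E2 * F2)"
        unfolding of_real_mult complex_norm_square gap W' unfolding W using nz by (simp add: mult_ac)
      also have "\<dots> = of_real ((2 * e)\<^sup>2)"
        by (simp add: E x_def power2_eq_square)
      finally show ?thesis by (simp only: of_real_eq_iff)
    qed
    moreover have "mass b c p = 1 + 4 * e\<^sup>2"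
      using Q unfolding x_def by (simp flip: of_real_eq_iff[where 'a=complex])
    ultimately show ?thesis
      using mass_minus_norm_sq[OF p, of b c] by simp
  qed
  then have "c \<noteq> b * p" by (auto simp: power_mult_distrib)
  moreover have "c \<noteq> 0" using nz E by (auto simp: c_eq)
  ultimately show "norm (family_p e t) < 1 \<and> family_c e t \<noteq> 0 \<and> family_c e t \<noteq> family_b e t * family_p e t \<and>
     (family_b e has_vector_derivative - \<i> * field_b (family_b e t) (family_c e t) (family_p e t)) (at t) \<and>
     (family_c e has_vector_derivative - \<i> * field_c (family_b e t) (family_c e t) (family_p e t)) (at t) \<and>
     (family_p e has_vector_derivative - \<i> * field_p (family_b e t) (family_c e t) (family_p e t)) (at t)"
    using p b' c' p' by (simp add: b_def c_def p_def)
qed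

text \<open>
  Uses \<open>k powr (2 * s) \<ge> K powr (2 * s - 1) * (k - K)\<close>, so that only the momentum and the mass of
  the tail enter. The choice \<open>K = 1 / (2 r)\<close> below leaves half of the momentum.
\<close>

lemma Hs_norm_wfun_ge:
  assumes p: "norm p < 1" and s: "s > 1/2" and K: "K > 0"
  shows "Hs_norm s (wfun b c p) \<ge>
    sqrt (K powr (2 * s - 1) * (norm c)\<^sup>2 * (1 / (pole_gap p)\<^sup>2 - K / pole_gap p))"
proof -
  define q where "q = (norm p)\<^sup>2"
  have q: "0 \<le> q" "q < 1" "1 - q = pole_gap p"
    using p by (simp_all add: q_def pole_gap_def power_less_one_iff)
  have "K powr (2 * s - 1) * (real n + 1 - K) \<le> (1 + (real n + 1)\<^sup>2) powr s" for n
  proof (cases "K \<le> real n + 1")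
    case True
    have "K powr (2 * s - 1) * (real n + 1 - K) \<le> (real n + 1) powr (2 * s - 1) * (real n + 1)"
      using True s K by (intro mult_mono powr_mono2) simp_all
    also have "\<dots> = ((real n + 1)\<^sup>2) powr s"
      by (simp add: powr_powr powr_diff flip: powr_numeral)
    also have "\<dots> \<le> (1 + (real n + 1)\<^sup>2) powr s"
      using s by (intro powr_mono2) simp_all
    finally show ?thesis .
  next
    case False
    then have "K powr (2 * s - 1) * (real n + 1 - K) \<le> 0"
      by (intro mult_nonneg_nonpos) simp_all
    also have "0 \<le> (1 + (real n + 1)\<^sup>2) powr s" by simp
    finally show ?thesis .
  qed
  then have le: "K powr (2 * s - 1) * (real (Suc n) * q ^ n - K * q ^ n) \<le> (1 + (real n + 1)\<^sup>2) powr s * q ^ n" for n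
    using mult_right_mono[of _ _ "q ^ n"] q(1) by (fastforce simp: algebra_simps)
  \<comment> \<open>After multiplication by the square of \<open>norm c\<close>, the series of
    \<open>(n + 1) * q ^ n\<close> gives the momentum and the geometric series gives the tail
    mass.\<close>
  have "(\<lambda>n. K powr (2 * s - 1) * (real (Suc n) * q ^ n - K * q ^ n)) sums
      (K powr (2 * s - 1) * (1 / (1 - q)\<^sup>2 - K * (1 / (1 - q))))"
    using q by (intro sums_mult sums_diff geometric_sums geometric_deriv_sums) simp_all
  then have "K powr (2 * s - 1) * (1 / (1 - q)\<^sup>2 - K * (1 / (1 - q)))
      \<le> (\<Sum>n. (1 + (real n + 1)\<^sup>2) powr s * q ^ n)"
    using q by (intro sums_le[OF le _ summable_sums] summable_Hs_geometric)
  then have "(norm c)\<^sup>2 * (K powr (2 * s - 1) * (1 / (1 - q)\<^sup>2 - K * (1 / (1 - q))))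
      \<le> (norm c)\<^sup>2 * (\<Sum>n. (1 + (real n + 1)\<^sup>2) powr s * q ^ n)"
    by (intro mult_left_mono) simp_all
  also have "\<dots> \<le> (norm b)\<^sup>2 + \<dots>" by simp
  finally show ?thesis
    unfolding Hs_norm_wfun[OF p] q_def[symmetric] q(3)[symmetric]
    by (intro real_sqrt_le_mono) (simp add: mult_ac)
qed

text \<open>\<open>T\<close> is a quarter period of the oscillation: the cosine vanishes and the
  sine is 1, so the pole is as close to the circle as it gets.\<close>

lemma family_peak:
  assumes "e > 0"
  defines "T \<equiv> pi / (2 * family_freq e)"
  shows "T > 0" "pole_gap (family_p e T) = e\<^sup>2 / (1 + e\<^sup>2)" "norm (family_c e T) = e\<^sup>2 / (1 + e\<^sup>2)"
proof -
  have w: "family_freq e > 0"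
    using assms by (simp add: family_freq_def add_pos_nonneg)
  then show "T > 0" by (simp add: T_def)
  have wT: "family_freq e * T = pi / 2"
    using w by (simp add: T_def)
  have "1 + e\<^sup>2 > 0" by (simp add: add_pos_nonneg)
  then show "pole_gap (family_p e T) = e\<^sup>2 / (1 + e\<^sup>2)"
    unfolding pole_gap_family wT by (simp add: field_simps)
  show "norm (family_c e T) = e\<^sup>2 / (1 + e\<^sup>2)"
    using assms(1) \<open>1 + e\<^sup>2 > 0\<close>
    by (simp add: family_c_def family_phase1_def family_phase2_def family_m_def wT norm_mult
        norm_divide norm_power power2_eq_square[symmetric] power_divide)
qed

lemma filterlim_Hs_norm_family_peak:
  assumes s: "s > 1/2"
  shows "filterlim (\<lambda>e. Hs_norm s (wfun (family_b e (pi / (2 * family_freq e)))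
    (family_c e (pi / (2 * family_freq e))) (family_p e (pi / (2 * family_freq e))))) at_top (at_right 0)"
proof (rule filterlim_at_top_mono)
  \<comment> \<open>With \<open>r\<close> the gap at the peak, \<open>norm c = r\<close> and
    \<open>K = 1 / (2 * r)\<close>, the lower bound of \<open>Hs_norm_wfun_ge\<close> reduces to the
    root of \<open>K powr (2 * s - 1) / 2\<close>. It diverges because \<open>2 * s - 1\<close> is
    positive.\<close>
  show "filterlim (\<lambda>e. sqrt (((1 + e\<^sup>2) / (2 * e\<^sup>2)) powr (2 * s - 1) / 2)) at_top (at_right (0::real))"
    using s by real_asymp
  have "sqrt (((1 + e\<^sup>2) / (2 * e\<^sup>2)) powr (2 * s - 1) / 2) \<le> Hs_norm s (wfun (family_b e T) (family_c e T) (family_p e T))"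
    if e: "e > 0" and T: "T = pi / (2 * family_freq e)" for e T
  proof -
    define r where "r = e\<^sup>2 / (1 + e\<^sup>2)"
    have "r > 0" using e by (simp add: r_def add_pos_nonneg)
    moreover have "(1 + e\<^sup>2) / (2 * e\<^sup>2) = 1 / (2 * r)" by (simp add: r_def)
    ultimately show ?thesis
      using Hs_norm_wfun_ge[of "family_p e T" s "1 / (2 * r)" "family_c e T" "family_b e T"]
        norm_family_p_less_1[of e T] s family_peak(2,3)[OF e, folded T r_def] e
      by (simp add: right_diff_distrib power2_eq_square)
  qed
  then show "\<forall>\<^sub>F e in at_right 0. sqrt (((1 + e\<^sup>2) / (2 * e\<^sup>2)) powr (2 * s - 1) / 2)
      \<le> Hs_norm s (wfun (family_b e (pi / (2 * family_freq e)))
        (family_c e (pi / (2 * family_freq e))) (family_p e (pi / (2 * family_freq e))))"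
    by (auto simp: eventually_at_right_less intro: eventually_mono[OF eventually_at_right_less])
qed

text \<open>One differentiation removes the constant, so only the order 0 involves a limit.\<close>

lemma Cinf_tendsto_add_const:
  assumes "(c \<longlongrightarrow> 0) F"
  shows "Cinf_tendsto (\<lambda>e z. f z + c e) f F"
  unfolding Cinf_tendsto_def
proof
  fix j
  show "uniform_limit UNIV (\<lambda>e. angular_deriv j (\<lambda>z. f z + c e)) (angular_deriv j f) F"
  proof (cases j)
    case 0
    then show ?thesis
      using assms by (auto simp: angular_deriv_def uniform_limit_iff tendsto_iff dist_norm)
  next
    case (Suc i)
    \<comment> \<open>\<open>vector_derivative\<close> chooses a value satisfying
      \<open>has_vector_derivative\<close>. The two functions admit the same values, so the choices
      coincide at every point.\<close>
    have "vector_derivative (\<lambda>x. f (cis x) + c e) (at x) = vector_derivative (\<lambda>x. f (cis x)) (at x)" for e x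
      unfolding vector_derivative_def by (simp add: has_vector_derivative_add_const)
    then have "angular_deriv j (\<lambda>z. f z + c e) = angular_deriv j f" for e
      by (simp add: Suc angular_deriv_def funpow_swap1 del: funpow.simps) (simp add: funpow_Suc_right del: funpow.simps)
    then show ?thesis by (simp add: uniform_limit_const)
  qed
qed

lemma wfun_family_0: "wfun (family_b e 0) (family_c e 0) (family_p e 0) z = z + 2 * of_real e"
  by (simp add: wfun_def geom_def family_b_def family_c_def family_p_def family_phase1_def
      family_phase2_def family_m_def)

theorem theorem1p3:
  shows "(\<forall>u. szego_solution_on_W3 u \<longrightarrow>
            (\<forall>s>1/2. (\<forall>t. u t \<in> Hs s) \<and> bdd_above (range (\<lambda>t. Hs_norm s (u t))))) \<and>
         (\<exists>(u0 :: real \<Rightarrow> complex \<Rightarrow> complex) v.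
            (\<forall>\<epsilon>>0. u0 \<epsilon> \<in> W3) \<and> v \<in> W3 \<and> Cinf_tendsto u0 v (at_right 0) \<and>
            (\<exists>u :: real \<Rightarrow> real \<Rightarrow> complex \<Rightarrow> complex.
               (\<forall>\<epsilon>>0. szego_solution_on_W3 (u \<epsilon>) \<and> (\<forall>z\<in>sphere 0 1. u \<epsilon> 0 z = u0 \<epsilon> z)) \<and>
               (\<exists>T :: real \<Rightarrow> real. (\<forall>\<epsilon>>0. T \<epsilon> > 0) \<and>
                  (\<forall>s>1/2. (\<forall>\<epsilon>>0. u \<epsilon> (T \<epsilon>) \<in> Hs s) \<and>
                     filterlim (\<lambda>\<epsilon>. Hs_norm s (u \<epsilon> (T \<epsilon>))) at_top (at_right 0)))))"
proof -
  define u where "u e t = wfun (family_b e t) (family_c e t) (family_p e t)" for e t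
  define u0 where "u0 e z = z + 2 * complex_of_real e" for e z
  \<comment> \<open>The time depends on \<open>e\<close> alone, so one choice serves every
    \<open>s\<close>.\<close>
  define T where "T e = pi / (2 * family_freq e)" for e
  have sol: "szego_solution_on_W3 (u e)" if "e > 0" for e
    unfolding u_def using that by (intro szego_ode_imp_solution_on_W3 family_ode) simp
  have u0: "u e 0 = u0 e" for e
    by (auto simp: u_def u0_def wfun_family_0)
  \<comment> \<open>The data lie in W(3) as the values at time 0 of solutions on W(3).\<close>
  have "u0 e \<in> W3" if "e > 0" for e
    using sol[OF that] unfolding u0[symmetric] szego_solution_on_W3_def by blast
  moreover have "(\<lambda>z. z) \<in> W3"
    unfolding W3_iff by (intro exI[of _ 0] exI[of _ 1] exI[of _ 0]) (simp add: wfun_def geom_def)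
  moreover have "((\<lambda>e. 2 * complex_of_real e) \<longlongrightarrow> 2 * complex_of_real 0) (at_right 0)"
    by (intro tendsto_intros)
  then have "Cinf_tendsto u0 (\<lambda>z. z) (at_right 0)"
    unfolding u0_def[abs_def] by (intro Cinf_tendsto_add_const) simp
  moreover have "T e > 0" if "e > 0" for e
    unfolding T_def using that by (rule family_peak(1))
  moreover have "u e (T e) \<in> Hs s" if "e > 0" for e s
    using szego_solution_on_W3_bounded(1)[OF sol[OF that]] .
  moreover have "filterlim (\<lambda>e. Hs_norm s (u e (T e))) at_top (at_right 0)" if "s > 1/2" for s
    unfolding u_def T_def using that by (rule filterlim_Hs_norm_family_peak)
  ultimately show ?thesis
    using szego_solution_on_W3_bounded sol u0
    by (intro conjI exI[of _ u0] exI[of _ "\<lambda>z. z"] exI[of _ u] exI[of _ T]) auto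
qed

end
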